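(* Assume the Continuum Hypothesis. Let $H$ be a separable infinite-dimensional complex Hilbert space with a fixed orthonormal basis $(e_n)_{n\in\mathbb N}$. Then there is an automorphism $\Phi$ of the Calkin algebra $\mathcal C(H)=\mathcal B(H)/\mathcal K(H)$ which is outer (i.e., not inner). Moreover, $\Phi$ can be chosen so that its restriction to (the image in $\mathcal C(H)$ of) the standard atomic masa is inner, and its restriction to any separable subalgebra of $\mathcal C(H)$ is inner.
   Context: $\mathcal B(H)$ is the algebra of bounded operators, $\mathcal K(H)$ the compact operators, $\pi\colon\mathcal B(H)\to\mathcal C(H)$ the quotient map. Automorphism means *-automorphism; an automorphism of $\mathcal C(H)$ is inner if it is of the form $x\mapsto vxv^*$ for a unitary $v\in\mathcal C(H)$. The standard atomic masa is the von Neumann algebra of all operators in $\mathcal B(H)$ diagonalized by $(e_n)$. The restriction of $\Phi$ to a subset $\mathcal Y\subseteq\mathcal C(H)$ is inner if there is an inner automorphism $\Phi'$ of $\mathcal C(H)$ with $\Phi(x)=\Phi'(x)$ for all $x\in\mathcal Y$. *)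

theory Defs
  imports "HOL-Analysis.Analysis" "HOL-Library.Equipollence"
begin

section \<open>Complex Hilbert spaces\<close>

class complex_vector = real_vector +
  fixes scaleC :: "complex \<Rightarrow> 'a \<Rightarrow> 'a"  (infixr \<open>*\<^sub>C\<close> 75)
  assumes scaleC_add_right: "a *\<^sub>C (x + y) = a *\<^sub>C x + a *\<^sub>C y"
    and scaleC_add_left: "(a + b) *\<^sub>C x = a *\<^sub>C x + b *\<^sub>C x"
    and scaleC_scaleC: "a *\<^sub>C b *\<^sub>C x = (a * b) *\<^sub>C x"
    and scaleC_of_real: "complex_of_real r *\<^sub>C x = r *\<^sub>R x"

lemma scaleC_one: "1 *\<^sub>C x = (x :: 'a :: complex_vector)"
  using scaleC_of_real[of 1 x] by simp

global_interpretation complex_vector: vector_space "scaleC :: complex \<Rightarrow> 'a \<Rightarrow> 'a :: complex_vector"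
  defines cspan = complex_vector.span
    and csubspace = complex_vector.subspace
  by unfold_locales
    (simp_all add: scaleC_add_right scaleC_add_left scaleC_scaleC scaleC_one)

class chilbert_space = complex_vector + banach +
  fixes cinner :: "'a \<Rightarrow> 'a \<Rightarrow> complex"
  assumes cinner_commute: "cinner x y = cnj (cinner y x)"
    and cinner_add_left: "cinner (x + y) z = cinner x z + cinner y z"
    and cinner_scaleC_left: "cinner (c *\<^sub>C x) y = c * cinner x y"
    and norm_eq_sqrt_cinner: "norm x = sqrt (Re (cinner x x))"

lemma cinner_add_right: "cinner x (y + z) = cinner x y + cinner (x :: 'a :: chilbert_space) z"
  by (metis cinner_add_left cinner_commute complex_cnj_add)

lemma cinner_scaleC_right: "cinner x (c *\<^sub>C y) = cnj c * cinner (x :: 'a :: chilbert_space) y"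
  by (metis cinner_scaleC_left cinner_commute complex_cnj_mult)

lemma cinner_minus_left: "cinner (- x) y = - cinner (x :: 'a :: chilbert_space) y"
  by (metis add_cancel_right_left add_eq_0_iff cinner_add_left minus_equation_iff)

lemma cinner_diff_left: "cinner (x - y) z = cinner x z - cinner (y :: 'a :: chilbert_space) z"
  using cinner_add_left[of x "- y" z] by (simp add: cinner_minus_left)

lemma cinner_diff_right: "cinner x (y - z) = cinner x y - cinner (x :: 'a :: chilbert_space) z"
  by (metis cinner_diff_left cinner_commute complex_cnj_diff)

lemma cinner_scaleR_left: "cinner (r *\<^sub>R x) y = of_real r * cinner (x :: 'a :: chilbert_space) y"
  by (metis cinner_scaleC_left scaleC_of_real)

lemma cinner_scaleR_right: "cinner x (r *\<^sub>R y) = of_real r * cinner (x :: 'a :: chilbert_space) y"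
  by (metis cinner_scaleC_right scaleC_of_real complex_cnj_complex_of_real)

lemma power2_norm_eq_Re_cinner: "(norm x)\<^sup>2 = Re (cinner x (x :: 'a :: chilbert_space))"
  using norm_ge_zero[of x] unfolding norm_eq_sqrt_cinner by simp

lemma cinner_self: "cinner x x = of_real ((norm (x :: 'a :: chilbert_space))\<^sup>2)"
proof -
  have "Im (cinner x x) = 0"
    using arg_cong[OF cinner_commute[of x x], of Im] by simp
  then show ?thesis
    by (simp add: complex_eq_iff power2_norm_eq_Re_cinner)
qed

lemma norm_scaleC: "norm (c *\<^sub>C x) = cmod c * norm (x :: 'a :: chilbert_space)"
proof -
  have "(norm (c *\<^sub>C x))\<^sup>2 = Re (c * cnj c * cinner x x)"
    by (simp only: power2_norm_eq_Re_cinner cinner_scaleC_left cinner_scaleC_right mult_ac)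
  also have "\<dots> = (cmod c * norm x)\<^sup>2"
    unfolding cinner_self complex_norm_square[symmetric]
    by (simp only: of_real_mult[symmetric] Re_complex_of_real power_mult_distrib)
  finally show ?thesis
    by (simp add: power2_eq_iff_nonneg)
qed

lemma Re_cinner_commute: "Re (cinner x y) = Re (cinner (y :: 'a :: chilbert_space) x)"
  by (metis cinner_commute complex_cnj(1) complex.sel(1) complex_surj)

lemma norm_add_square:
  "(norm (x + y))\<^sup>2 = (norm x)\<^sup>2 + 2 * Re (cinner x y) + (norm (y :: 'a :: chilbert_space))\<^sup>2"
  using Re_cinner_commute[of y x]
  by (simp add: power2_norm_eq_Re_cinner cinner_add_left cinner_add_right)

lemma norm_diff_square:
  "(norm (x - y))\<^sup>2 = (norm x)\<^sup>2 - 2 * Re (cinner x y) + (norm (y :: 'a :: chilbert_space))\<^sup>2"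
  using Re_cinner_commute[of y x]
  by (simp add: power2_norm_eq_Re_cinner cinner_diff_left cinner_diff_right)

lemma Re_cinner_le: "Re (cinner x y) \<le> norm x * norm (y :: 'a :: chilbert_space)"
proof -
  have "(norm (x + y))\<^sup>2 \<le> (norm x + norm y)\<^sup>2"
    by (intro power_mono norm_triangle_ineq) auto
  then show ?thesis
    by (simp add: norm_add_square power2_sum)
qed

lemma cinner_eqI:
  assumes "\<And>x. Re (cinner x y) = Re (cinner x (z :: 'a :: chilbert_space))"
  shows "y = z"
proof -
  have "(norm (y - z))\<^sup>2 = 0"
    using assms[of "y - z"] by (simp add: power2_norm_eq_Re_cinner cinner_diff_right)
  then show ?thesis by simp
qed

text \<open>A space with such a basis is automatically separable and infinite-dimensional.\<close>

definition orthonormal_basis :: "(nat \<Rightarrow> 'a :: chilbert_space) \<Rightarrow> bool" where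
  "orthonormal_basis e \<longleftrightarrow>
     (\<forall>m n. cinner (e m) (e n) = (if m = n then 1 else 0)) \<and> closure (cspan (range e)) = UNIV"

lemma Riesz_Re:
  fixes f :: "'a :: chilbert_space \<Rightarrow> real"
  assumes f: "bounded_linear f"
  shows "\<exists>z. \<forall>x. f x = Re (cinner x z)"
proof -
  interpret f: bounded_linear f by fact
  define J where "J x = (norm x)\<^sup>2 - 2 * f x" for x
  obtain K where K: "\<And>x. norm (f x) \<le> norm x * K"
    using f.bounded by blast
  have J_lower: "J x \<ge> - K\<^sup>2" for x
  proof -
    have "f x \<le> norm x * K"
      using K[of x] by simp
    moreover have "0 \<le> (norm x - K)\<^sup>2" by simp
    ultimately show ?thesis
      unfolding J_def power2_diff by (simp add: algebra_simps)
  qed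
  define m where "m = Inf (range J)"
  have bdd: "bdd_below (range J)"
    using J_lower by (auto intro!: bdd_belowI[of _ "- K\<^sup>2"])
  have m: "m \<le> J x" for x
    unfolding m_def by (rule cInf_lower) (use bdd in auto)
  have "\<exists>x. J x < m + 1 / real (Suc n)" for n
    using cInf_less_iff[of "range J" "m + 1 / real (Suc n)"] bdd by (auto simp: m_def)
  then obtain X where X: "\<And>n. J (X n) < m + 1 / real (Suc n)"
    by metis
  have par: "(norm (x - y))\<^sup>2 \<le> 2 * (J x - m) + 2 * (J y - m)" for x y
  proof -
    have "norm ((1/2) *\<^sub>R (x + y)) = norm (x + y) / 2" by simp
    moreover have "f ((1/2) *\<^sub>R (x + y)) = (f x + f y) / 2"
      by (simp only: f.scaleR f.add) simp
    ultimately have "J ((1/2) *\<^sub>R (x + y)) = (norm (x + y))\<^sup>2 / 4 - (f x + f y)"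
      unfolding J_def by (simp only: power_divide) (simp add: add_divide_distrib)
    then show ?thesis
      using m[of "(1/2) *\<^sub>R (x + y)"] unfolding J_def norm_add_square norm_diff_square
      by (simp add: field_simps)
  qed
  have "Cauchy X"
  proof (rule metric_CauchyI)
    fix e :: real assume e: "e > 0"
    obtain N where N: "4 / real (Suc N) < e\<^sup>2"
      using e reals_Archimedean[of "e\<^sup>2 / 4"] by (auto simp: field_simps)
    show "\<exists>M. \<forall>p\<ge>M. \<forall>q\<ge>M. dist (X p) (X q) < e"
    proof (intro exI[of _ N] allI impI)
      fix p q assume pq: "p \<ge> N" "q \<ge> N"
      have *: "1 / real (Suc k) \<le> 1 / real (Suc N)" if "k \<ge> N" for k
        using that by (simp add: frac_le)
      have "(norm (X p - X q))\<^sup>2 < 4 / real (Suc N)"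
        using par[of "X p" "X q"] X[of p] X[of q] *[OF pq(1)] *[OF pq(2)] by simp
      then have "(norm (X p - X q))\<^sup>2 < e\<^sup>2" using N by simp
      then show "dist (X p) (X q) < e"
        using e by (simp add: dist_norm power2_less_imp_less)
    qed
  qed
  then obtain z where z: "X \<longlonglongrightarrow> z"
    using Cauchy_convergent_iff convergent_def by blast
  have "(\<lambda>n. J (X n)) \<longlonglongrightarrow> J z"
    unfolding J_def by (intro tendsto_intros f.tendsto z)
  moreover have "(\<lambda>n. m + 1 / real (Suc n)) \<longlonglongrightarrow> m + 0"
    by (intro tendsto_intros LIMSEQ_inverse_real_of_nat[unfolded inverse_eq_divide])
  ultimately have "J z \<le> m + 0"
    by (rule LIMSEQ_le) (use X in \<open>auto intro: less_imp_le\<close>)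
  then have Jz: "J z \<le> J x" for x
    using m[of x] by simp
  have "f x = Re (cinner x z)" for x
  proof -
    define b where "b = Re (cinner x z) - f x"
    have quad: "0 \<le> t\<^sup>2 * (norm x)\<^sup>2 + 2 * t * b" for t
      using Jz[of "z + t *\<^sub>R x"] Re_cinner_commute[of z x] unfolding J_def norm_add_square b_def
      by (simp add: f.add f.scaleR cinner_scaleR_right power_mult_distrib algebra_simps)
    define s where "s = (norm x)\<^sup>2 + 1"
    have s: "s > 0" unfolding s_def by (simp add: add_nonneg_pos)
    have "0 \<le> (- b / s)\<^sup>2 * (norm x)\<^sup>2 + 2 * (- b / s) * b" by (rule quad)
    also have "\<dots> = (b\<^sup>2 / s\<^sup>2) * (s - 1) - 2 * b\<^sup>2 / s"
      by (simp add: s_def power_divide power2_eq_square)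
    also have "\<dots> = - (b\<^sup>2 / s\<^sup>2) - b\<^sup>2 / s"
      using s by (simp add: field_simps power2_eq_square)
    finally have "b\<^sup>2 / s\<^sup>2 + b\<^sup>2 / s \<le> 0" by simp
    moreover have "b\<^sup>2 / s\<^sup>2 \<ge> 0" using s by simp
    ultimately have "b\<^sup>2 / s \<le> 0" by linarith
    then have "b = 0" using s by (simp add: divide_le_0_iff)
    then show ?thesis by (simp add: b_def)
  qed
  then show ?thesis by blast
qed


section \<open>The algebra of bounded operators\<close>

text \<open>The space \<open>'a \<Rightarrow>\<^sub>L 'a\<close> consists of the real-linear bounded maps.\<close>

typedef (overloaded) 'a bop =
  "{f :: 'a :: chilbert_space \<Rightarrow>\<^sub>L 'a. \<forall>c x. f (c *\<^sub>C x) = c *\<^sub>C f x}"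
  by (rule exI[of _ 0]) auto

setup_lifting type_definition_bop

lift_definition bop_apply :: "'a :: chilbert_space bop \<Rightarrow> 'a \<Rightarrow> 'a" is blinfun_apply .

lemma bop_apply_bounded_linear: "bounded_linear (bop_apply a)"
  by transfer (rule blinfun.bounded_linear_right)

lemma bop_apply_scaleC: "bop_apply a (c *\<^sub>C x) = c *\<^sub>C bop_apply a x"
  by transfer auto

lemma bop_eqI: "(\<And>x. bop_apply a x = bop_apply b x) \<Longrightarrow> a = b"
  by transfer (auto intro: blinfun_eqI)

lemma scaleC_blinfun:
  fixes f :: "'a :: real_normed_vector \<Rightarrow>\<^sub>L 'b :: chilbert_space"
  shows "bounded_linear (\<lambda>x. c *\<^sub>C f x)"
proof (rule bounded_linear_intro[of _ "cmod c * norm f"])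
  fix x y :: 'a and r :: real
  show "c *\<^sub>C f (x + y) = c *\<^sub>C f x + c *\<^sub>C f y"
    by (simp add: blinfun.add_right scaleC_add_right)
  show "c *\<^sub>C f (r *\<^sub>R x) = r *\<^sub>R c *\<^sub>C f x"
    by (simp add: blinfun.scaleR_right scaleC_scaleC mult.commute flip: scaleC_of_real)
  show "norm (c *\<^sub>C f x) \<le> norm x * (cmod c * norm f)"
    using mult_left_mono[OF norm_blinfun[of f x], of "cmod c"]
    by (simp add: norm_scaleC mult_ac)
qed

instantiation bop :: (chilbert_space) "{complex_vector, real_normed_algebra, monoid_mult}"
begin

lift_definition zero_bop :: "'a bop" is 0 by simp
lift_definition one_bop :: "'a bop" is id_blinfun by simp
lift_definition plus_bop :: "'a bop \<Rightarrow> 'a bop \<Rightarrow> 'a bop" is "(+)"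
  by (simp add: blinfun.add_left scaleC_add_right)
lift_definition uminus_bop :: "'a bop \<Rightarrow> 'a bop" is uminus
  by (simp add: blinfun.minus_left)
lift_definition minus_bop :: "'a bop \<Rightarrow> 'a bop \<Rightarrow> 'a bop" is "(-)"
  by (simp add: blinfun.diff_left complex_vector.scale_right_diff_distrib)
lift_definition times_bop :: "'a bop \<Rightarrow> 'a bop \<Rightarrow> 'a bop" is "(o\<^sub>L)"
  by simp
lift_definition scaleR_bop :: "real \<Rightarrow> 'a bop \<Rightarrow> 'a bop" is "(*\<^sub>R)"
  by (simp add: blinfun.scaleR_left scaleC_scaleC mult.commute flip: scaleC_of_real)
lift_definition scaleC_bop :: "complex \<Rightarrow> 'a bop \<Rightarrow> 'a bop" 
  is "\<lambda>c f. Blinfun (\<lambda>x. c *\<^sub>C blinfun_apply f x)"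
  by (simp add: bounded_linear_Blinfun_apply scaleC_blinfun scaleC_scaleC mult.commute)
lift_definition norm_bop :: "'a bop \<Rightarrow> real" is norm .

definition sgn_bop :: "'a bop \<Rightarrow> 'a bop" where "sgn_bop a = inverse (norm a) *\<^sub>R a"
definition dist_bop :: "'a bop \<Rightarrow> 'a bop \<Rightarrow> real" where "dist_bop a b = norm (a - b)"
definition uniformity_bop :: "('a bop \<times> 'a bop) filter"
  where "uniformity_bop = (INF e\<in>{0 <..}. principal {(x, y). dist x y < e})"
definition open_bop :: "'a bop set \<Rightarrow> bool"
  where "open_bop S = (\<forall>x\<in>S. \<forall>\<^sub>F (x', y) in uniformity. x' = x \<longrightarrow> y \<in> S)"

lemma bop_apply_simps [simp]:
  "bop_apply 0 x = 0"
  "bop_apply 1 x = x"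
  "bop_apply (a + b) x = bop_apply a x + bop_apply b x"
  "bop_apply (- a) x = - bop_apply a x"
  "bop_apply (a - b) x = bop_apply a x - bop_apply b x"
  "bop_apply (a * b) x = bop_apply a (bop_apply b x)"
  "bop_apply (r *\<^sub>R a) x = r *\<^sub>R bop_apply a x"
  "bop_apply (c *\<^sub>C a) x = c *\<^sub>C bop_apply a x"
  by (transfer; simp add: blinfun.bilinear_simps bounded_linear_Blinfun_apply scaleC_blinfun)+

instance
proof
  fix a b c :: "'a bop" and p q :: complex and r s :: real
  show "a + b + c = a + (b + c)" by transfer simp
  show "a + b = b + a" by transfer simp
  show "0 + a = a" by transfer simp
  show "- a + a = 0" by transfer simp
  show "a - b = a + - b" by transfer simp
  show "r *\<^sub>R (a + b) = r *\<^sub>R a + r *\<^sub>R b" by transfer (simp add: scaleR_add_right)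
  show "(r + s) *\<^sub>R a = r *\<^sub>R a + s *\<^sub>R a" by transfer (simp add: scaleR_add_left)
  show "r *\<^sub>R s *\<^sub>R a = (r * s) *\<^sub>R a" by transfer simp
  show "1 *\<^sub>R a = a" by transfer simp
  show "p *\<^sub>C (a + b) = p *\<^sub>C a + p *\<^sub>C b"
    by (rule bop_eqI) (simp add: scaleC_add_right)
  show "(p + q) *\<^sub>C a = p *\<^sub>C a + q *\<^sub>C a"
    by (rule bop_eqI) (simp add: scaleC_add_left)
  show "p *\<^sub>C q *\<^sub>C a = (p * q) *\<^sub>C a"
    by (rule bop_eqI) (simp add: scaleC_scaleC)
  show "complex_of_real r *\<^sub>C a = r *\<^sub>R a"
    by (rule bop_eqI) (simp add: scaleC_of_real)
  show "a * b * c = a * (b * c)" by transfer (auto intro: blinfun_eqI)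
  show "(a + b) * c = a * c + b * c"
    by transfer (auto intro!: blinfun_eqI simp: blinfun.add_left)
  show "a * (b + c) = a * b + a * c"
    by transfer (auto intro!: blinfun_eqI simp: blinfun.add_left blinfun.add_right)
  show "r *\<^sub>R a * b = r *\<^sub>R (a * b)"
    by transfer (auto intro!: blinfun_eqI simp: blinfun.scaleR_left)
  show "a * r *\<^sub>R b = r *\<^sub>R (a * b)"
    by transfer (auto intro!: blinfun_eqI simp: blinfun.scaleR_left blinfun.scaleR_right)
  show "1 * a = a" by transfer (auto intro: blinfun_eqI)
  show "a * 1 = a" by transfer (auto intro: blinfun_eqI)
  show "norm a = 0 \<longleftrightarrow> a = 0" by transfer simp
  show "norm (a + b) \<le> norm a + norm b" by transfer (rule norm_triangle_ineq)
  show "norm (r *\<^sub>R a) = \<bar>r\<bar> * norm a" by transfer simp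
  show "norm (a * b) \<le> norm a * norm b" by transfer (rule norm_blinfun_compose)
qed (simp_all add: sgn_bop_def dist_bop_def uniformity_bop_def open_bop_def)

end

lemma norm_bop_apply: "norm (bop_apply a x) \<le> norm a * norm x"
  by transfer (rule norm_blinfun)

lemma adjoint_exists: "\<exists>z. \<forall>x. cinner (bop_apply a x) y = cinner x z"
proof -
  interpret a: bounded_linear "bop_apply a" by (rule bop_apply_bounded_linear)
  have "bounded_linear (\<lambda>x. Re (cinner (bop_apply a x) y))"
  proof (rule bounded_linear_intro[of _ "norm a * norm y"])
    fix u v :: 'a and r :: real
    show "Re (cinner (bop_apply a (u + v)) y) = Re (cinner (bop_apply a u) y) + Re (cinner (bop_apply a v) y)"
      by (simp add: a.add cinner_add_left)
    show "Re (cinner (bop_apply a (r *\<^sub>R u)) y) = r *\<^sub>R Re (cinner (bop_apply a u) y)"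
      by (simp add: a.scaleR cinner_scaleR_left)
    have "norm (bop_apply a u) * norm y \<le> norm u * (norm a * norm y)"
      using mult_right_mono[OF norm_bop_apply[of a u], of "norm y"] by (simp add: mult_ac)
    then show "norm (Re (cinner (bop_apply a u) y)) \<le> norm u * (norm a * norm y)"
      using Re_cinner_le[of "bop_apply a u" y] Re_cinner_le[of "- bop_apply a u" y]
      by (simp add: cinner_minus_left)
  qed
  then obtain z where z: "\<And>x. Re (cinner (bop_apply a x) y) = Re (cinner x z)"
    using Riesz_Re by blast
  have "cinner (bop_apply a x) y = cinner x z" for x
    using z[of x] z[of "\<i> *\<^sub>C x"]
    by (simp add: complex_eq_iff bop_apply_scaleC cinner_scaleC_left)
  then show ?thesis by blast
qed

lemma adjoint_unique: "\<exists>!b. \<forall>x y. cinner (bop_apply a x) y = cinner x (bop_apply b y)"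
proof (rule ex_ex1I)
  obtain g where g: "\<And>x y. cinner (bop_apply a x) y = cinner x (g y)"
    using adjoint_exists[of a] by metis
  have lin: "g (x + y) = g x + g y" "g (r *\<^sub>R x) = r *\<^sub>R g x" "g (c *\<^sub>C x) = c *\<^sub>C g x" for x y r c
    by (rule cinner_eqI; simp add: cinner_add_right cinner_scaleR_right cinner_scaleC_right flip: g)+
  have bd: "norm (g y) \<le> norm y * norm a" for y
  proof -
    have "norm (g y) * norm (g y) = Re (cinner (bop_apply a (g y)) y)"
      by (simp add: g cinner_self power2_eq_square)
    also have "\<dots> \<le> norm (bop_apply a (g y)) * norm y" by (rule Re_cinner_le)
    also have "\<dots> \<le> (norm a * norm (g y)) * norm y"
      by (intro mult_right_mono norm_bop_apply) simp
    finally have "norm (g y) * norm (g y) \<le> (norm y * norm a) * norm (g y)"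
      by (simp add: mult_ac)
    then show ?thesis
      by (cases "g y = 0") (auto simp: mult_le_cancel_right)
  qed
  have g_bl: "bounded_linear g"
    by (rule bounded_linear_intro[of _ "norm a"]) (use lin bd in auto)
  have "bop_apply (Abs_bop (Blinfun g)) = g"
    by (simp add: bop_apply.rep_eq Abs_bop_inverse bounded_linear_Blinfun_apply g_bl lin)
  with g show "\<exists>b. \<forall>x y. cinner (bop_apply a x) y = cinner x (bop_apply b y)"
    by metis
next
  fix b c
  assume b: "\<forall>x y. cinner (bop_apply a x) y = cinner x (bop_apply b y)"
    and c: "\<forall>x y. cinner (bop_apply a x) y = cinner x (bop_apply c y)"
  show "b = c"
    by (intro bop_eqI cinner_eqI) (metis b c)
qed

definition bop_adj :: "'a :: chilbert_space bop \<Rightarrow> 'a bop" where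
  "bop_adj a = (THE b. \<forall>x y. cinner (bop_apply a x) y = cinner x (bop_apply b y))"

lemma cinner_bop_adj: "cinner (bop_apply a x) y = cinner x (bop_apply (bop_adj a) y)"
  using theI'[OF adjoint_unique[of a]] unfolding bop_adj_def by blast

lemma bop_adj_diff: "bop_adj (a - b) = bop_adj a - bop_adj b"
  by (intro bop_eqI cinner_eqI)
    (simp add: cinner_diff_left cinner_diff_right flip: cinner_bop_adj)


section \<open>Compact operators\<close>

definition compact_op :: "'a :: chilbert_space bop \<Rightarrow> bool" where
  "compact_op a \<longleftrightarrow> compact (closure (bop_apply a ` cball 0 1))"

lemma compact_op_iff_net:
  "compact_op a \<longleftrightarrow>
     (\<forall>e>0. \<exists>F. finite F \<and> (\<forall>x. norm x \<le> 1 \<longrightarrow> (\<exists>y\<in>F. norm (bop_apply a x - y) < e)))"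
    (is "_ \<longleftrightarrow> ?R")
proof
  assume "compact_op a"
  then have tb: "\<forall>e>0. \<exists>k. finite k \<and> closure (bop_apply a ` cball 0 1) \<subseteq> (\<Union>x\<in>k. ball x e)"
    unfolding compact_op_def compact_eq_totally_bounded by blast
  show ?R
  proof (intro allI impI)
    fix e :: real assume "e > 0"
    with tb obtain k where k: "finite k" "closure (bop_apply a ` cball 0 1) \<subseteq> (\<Union>x\<in>k. ball x e)"
      by blast
    have "\<exists>y\<in>k. norm (bop_apply a x - y) < e" if "norm x \<le> 1" for x
    proof -
      have "bop_apply a x \<in> closure (bop_apply a ` cball 0 1)"
        using that by (intro subsetD[OF closure_subset]) auto
      with k(2) obtain z where z: "z \<in> k" "bop_apply a x \<in> ball z e"
        by blast
      then show ?thesis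
        by (intro bexI[of _ z]) (simp_all add: dist_norm norm_minus_commute)
    qed
    with k(1) show "\<exists>F. finite F \<and> (\<forall>x. norm x \<le> 1 \<longrightarrow> (\<exists>y\<in>F. norm (bop_apply a x - y) < e))"
      by blast
  qed
next
  assume R: ?R
  show "compact_op a"
    unfolding compact_op_def compact_eq_totally_bounded
  proof (intro conjI allI impI)
    show "complete (closure (bop_apply a ` cball 0 1))"
      by (simp add: complete_eq_closed)
    fix e :: real assume e: "e > 0"
    with R obtain F where F: "finite F"
      "\<And>x. norm x \<le> 1 \<Longrightarrow> \<exists>y\<in>F. norm (bop_apply a x - y) < e / 2"
      by (meson half_gt_zero)
    have "bop_apply a ` cball 0 1 \<subseteq> (\<Union>x\<in>F. cball x (e / 2))"
      using F(2) by (fastforce simp: dist_norm norm_minus_commute)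
    moreover have "closed (\<Union>x\<in>F. cball x (e / 2))"
      using F(1) by (intro closed_UN) auto
    ultimately have "closure (bop_apply a ` cball 0 1) \<subseteq> (\<Union>x\<in>F. cball x (e / 2))"
      by (rule closure_minimal)
    also have "\<dots> \<subseteq> (\<Union>x\<in>F. ball x e)"
      using e by (intro UN_mono) auto
    finally show "\<exists>k. finite k \<and> closure (bop_apply a ` cball 0 1) \<subseteq> (\<Union>x\<in>k. ball x e)"
      using F(1) by blast
  qed
qed

lemma compact_op_netD:
  assumes "compact_op a" "e > 0"
  obtains F where "finite F" "\<And>x. norm x \<le> 1 \<Longrightarrow> \<exists>y\<in>F. norm (bop_apply a x - y) < e"
  using assms unfolding compact_op_iff_net by blast

lemma compact_op_zero: "compact_op 0"
  unfolding compact_op_iff_net by (auto intro!: exI[of _ "{0}"])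

lemma compact_op_add:
  assumes a: "compact_op a" and b: "compact_op b"
  shows "compact_op (a + b)"
  unfolding compact_op_iff_net
proof (intro allI impI)
  fix e :: real assume "e > 0"
  then have e: "e / 2 > 0" by simp
  obtain F where F: "finite F" "\<And>x. norm x \<le> 1 \<Longrightarrow> \<exists>y\<in>F. norm (bop_apply a x - y) < e / 2"
    using compact_op_netD[OF a e] by blast
  obtain G where G: "finite G" "\<And>x. norm x \<le> 1 \<Longrightarrow> \<exists>y\<in>G. norm (bop_apply b x - y) < e / 2"
    using compact_op_netD[OF b e] by blast
  have "\<exists>w\<in>(\<lambda>(y, z). y + z) ` (F \<times> G). norm (bop_apply (a + b) x - w) < e" if x: "norm x \<le> 1" for x
  proof -
    obtain y z where yz: "y \<in> F" "norm (bop_apply a x - y) < e / 2"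
        "z \<in> G" "norm (bop_apply b x - z) < e / 2"
      using F(2)[OF x] G(2)[OF x] by blast
    have "norm (bop_apply (a + b) x - (y + z)) < e"
      using norm_triangle_ineq[of "bop_apply a x - y" "bop_apply b x - z"] yz(2,4)
      by (simp add: algebra_simps)
    then show ?thesis using yz(1,3) by force
  qed
  then show "\<exists>F. finite F \<and> (\<forall>x. norm x \<le> 1 \<longrightarrow> (\<exists>y\<in>F. norm (bop_apply (a + b) x - y) < e))"
    using F(1) G(1) by (intro exI[of _ "(\<lambda>(y, z). y + z) ` (F \<times> G)"]) auto
qed

lemma compact_op_mult_left:
  assumes b: "compact_op b"
  shows "compact_op (a * b)"
  unfolding compact_op_iff_net
proof (intro allI impI)
  fix e :: real assume e: "e > 0"
  interpret a: bounded_linear "bop_apply a" by (rule bop_apply_bounded_linear)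
  define d where "d = e / (norm a + 1)"
  have pos: "norm a + 1 > 0" by (simp add: add_nonneg_pos)
  have d: "d > 0" using e pos by (simp add: d_def)
  obtain F where F: "finite F" "\<And>x. norm x \<le> 1 \<Longrightarrow> \<exists>y\<in>F. norm (bop_apply b x - y) < d"
    using compact_op_netD[OF b d] by blast
  have "\<exists>w\<in>bop_apply a ` F. norm (bop_apply (a * b) x - w) < e" if x: "norm x \<le> 1" for x
  proof -
    obtain y where y: "y \<in> F" "norm (bop_apply b x - y) < d" using F(2)[OF x] by blast
    have "norm (bop_apply (a * b) x - bop_apply a y) \<le> norm a * norm (bop_apply b x - y)"
      using norm_bop_apply[of a "bop_apply b x - y"] by (simp add: a.diff)
    also have "\<dots> \<le> norm a * d" using y(2) by (intro mult_left_mono) auto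
    also have "\<dots> < e"
      using mult_strict_right_mono[of "norm a" "norm a + 1" d] d pos by (simp add: d_def)
    finally show ?thesis using y(1) by blast
  qed
  then show "\<exists>F. finite F \<and> (\<forall>x. norm x \<le> 1 \<longrightarrow> (\<exists>y\<in>F. norm (bop_apply (a * b) x - y) < e))"
    using F(1) by (intro exI[of _ "bop_apply a ` F"]) auto
qed

lemma compact_op_mult_right:
  assumes a: "compact_op a"
  shows "compact_op (a * b)"
  unfolding compact_op_iff_net
proof (intro allI impI)
  fix e :: real assume e: "e > 0"
  interpret a: bounded_linear "bop_apply a" by (rule bop_apply_bounded_linear)
  define s where "s = norm b + 1"
  have s: "s > 0" by (simp add: s_def add_nonneg_pos)
  obtain F where F: "finite F" "\<And>x. norm x \<le> 1 \<Longrightarrow> \<exists>y\<in>F. norm (bop_apply a x - y) < e / s"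
    using compact_op_netD[OF a, of "e / s"] e s by auto
  have "\<exists>w\<in>(*\<^sub>R) s ` F. norm (bop_apply (a * b) x - w) < e" if x: "norm x \<le> 1" for x
  proof -
    have "norm (bop_apply b x) \<le> norm b * 1"
      using norm_bop_apply[of b x] mult_left_mono[OF x norm_ge_zero[of b]] by linarith
    then have "norm ((1 / s) *\<^sub>R bop_apply b x) \<le> 1"
      using s by (simp add: s_def field_simps)
    then obtain y where y: "y \<in> F" "norm (bop_apply a ((1 / s) *\<^sub>R bop_apply b x) - y) < e / s"
      using F(2) by blast
    have "bop_apply (a * b) x - s *\<^sub>R y = s *\<^sub>R (bop_apply a ((1 / s) *\<^sub>R bop_apply b x) - y)"
      using s by (simp add: a.scaleR scaleR_diff_right)
    then have "norm (bop_apply (a * b) x - s *\<^sub>R y) < e"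
      using y(2) s by (simp only: norm_scaleR) (simp add: field_simps)
    then show ?thesis using y(1) by blast
  qed
  then show "\<exists>F. finite F \<and> (\<forall>x. norm x \<le> 1 \<longrightarrow> (\<exists>y\<in>F. norm (bop_apply (a * b) x - y) < e))"
    using F(1) by (intro exI[of _ "(*\<^sub>R) s ` F"]) auto
qed

lemma compact_op_scaleC: "compact_op a \<Longrightarrow> compact_op (c *\<^sub>C a)"
proof -
  have "c *\<^sub>C a = (c *\<^sub>C 1) * a" by (rule bop_eqI) simp
  then show "compact_op a \<Longrightarrow> compact_op (c *\<^sub>C a)" by (simp add: compact_op_mult_left)
qed

lemma compact_op_scaleR: "compact_op a \<Longrightarrow> compact_op (r *\<^sub>R a)"
  by (metis compact_op_scaleC scaleC_of_real)

lemma compact_op_uminus: "compact_op a \<Longrightarrow> compact_op (- a)"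
  using compact_op_scaleR[of a "-1"] by simp

lemma compact_op_diff: "compact_op a \<Longrightarrow> compact_op b \<Longrightarrow> compact_op (a - b)"
  using compact_op_add[of a "- b"] compact_op_uminus[of b] by simp

lemma compact_op_adj:
  assumes "compact_op a"
  shows "compact_op (bop_adj a)"
  unfolding compact_op_iff_net
proof (intro allI impI)
  fix e :: real assume e: "e > 0"
  let ?t = "bop_adj a"
  interpret t: bounded_linear "bop_apply ?t" by (rule bop_apply_bounded_linear)
  interpret p: bounded_linear "bop_apply (a * ?t)" by (rule bop_apply_bounded_linear)
  have "compact_op (a * ?t)" using assms by (rule compact_op_mult_right)
  moreover have "e\<^sup>2 / 4 > 0" using e by simp
  ultimately obtain F where F: "finite F"
    "\<And>x. norm x \<le> 1 \<Longrightarrow> \<exists>y\<in>F. norm (bop_apply (a * ?t) x - y) < e\<^sup>2 / 4"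
    using compact_op_netD by blast
  define c where "c y = (SOME x. norm x \<le> 1 \<and> norm (bop_apply (a * ?t) x - y) < e\<^sup>2 / 4)" for y
  have "\<exists>w\<in>(\<lambda>y. bop_apply ?t (c y)) ` F. norm (bop_apply ?t x - w) < e" if x: "norm x \<le> 1" for x
  proof -
    obtain y where y: "y \<in> F" "norm (bop_apply (a * ?t) x - y) < e\<^sup>2 / 4" using F(2)[OF x] by blast
    have c: "norm (c y) \<le> 1 \<and> norm (bop_apply (a * ?t) (c y) - y) < e\<^sup>2 / 4"
      unfolding c_def by (rule someI[of _ x]) (use x y in auto)
    define u where "u = x - c y"
    have u: "norm u \<le> 2" unfolding u_def using norm_triangle_ineq4[of x "c y"] x c by linarith
    have pu: "norm (bop_apply (a * ?t) u) < e\<^sup>2 / 2"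
      using norm_triangle_ineq4[of "bop_apply (a * ?t) x - y" "bop_apply (a * ?t) (c y) - y"] y(2) c
      unfolding u_def p.diff by simp
    have "(norm (bop_apply ?t u))\<^sup>2 = Re (cinner (bop_apply (a * ?t) u) u)"
      by (simp add: power2_norm_eq_Re_cinner cinner_bop_adj)
    also have "\<dots> \<le> norm (bop_apply (a * ?t) u) * norm u" by (rule Re_cinner_le)
    also have "\<dots> \<le> norm (bop_apply (a * ?t) u) * 2" by (intro mult_left_mono u) simp
    also have "\<dots> < e\<^sup>2" using pu by simp
    finally have "norm (bop_apply ?t u) < e"
      using e by (simp add: power2_less_imp_less)
    then show ?thesis using y(1) by (auto simp: u_def t.diff)
  qed
  then show "\<exists>F. finite F \<and> (\<forall>x. norm x \<le> 1 \<longrightarrow> (\<exists>y\<in>F. norm (bop_apply ?t x - y) < e))"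
    using F(1) by (intro exI[of _ "(\<lambda>y. bop_apply ?t (c y)) ` F"]) auto
qed

lemma compact_op_limit:
  assumes "\<And>e. e > 0 \<Longrightarrow> \<exists>k. compact_op k \<and> norm (a - k) < e"
  shows "compact_op a"
  unfolding compact_op_iff_net
proof (intro allI impI)
  fix e :: real assume "e > 0"
  then have e: "e / 2 > 0" by simp
  obtain k where k: "compact_op k" "norm (a - k) < e / 2" using assms[OF e] by blast
  obtain F where F: "finite F" "\<And>x. norm x \<le> 1 \<Longrightarrow> \<exists>y\<in>F. norm (bop_apply k x - y) < e / 2"
    using compact_op_netD[OF k(1) e] by blast
  have "\<exists>y\<in>F. norm (bop_apply a x - y) < e" if x: "norm x \<le> 1" for x
  proof -
    obtain y where y: "y \<in> F" "norm (bop_apply k x - y) < e / 2" using F(2)[OF x] by blast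
    have "norm (bop_apply (a - k) x) \<le> norm (a - k)"
      using norm_bop_apply[of "a - k" x] mult_left_mono[OF x norm_ge_zero[of "a - k"]] by linarith
    then have "norm (bop_apply a x - y) < e"
      using norm_triangle_ineq[of "bop_apply (a - k) x" "bop_apply k x - y"] k(2) y(2) by simp
    then show ?thesis using y(1) by blast
  qed
  then show "\<exists>F. finite F \<and> (\<forall>x. norm x \<le> 1 \<longrightarrow> (\<exists>y\<in>F. norm (bop_apply a x - y) < e))"
    using F(1) by blast
qed


section \<open>The Calkin algebra\<close>

lifting_forget bop.lifting

definition compact_perturb :: "'a :: chilbert_space bop \<Rightarrow> 'a bop \<Rightarrow> bool" where
  "compact_perturb a b \<longleftrightarrow> compact_op (a - b)"

quotient_type (overloaded) 'a calkin = "'a :: chilbert_space bop" / compact_perturb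
proof (rule equivpI)
  show "reflp (compact_perturb :: 'a bop \<Rightarrow> _)"
    by (simp add: reflp_def compact_perturb_def compact_op_zero)
  show "symp (compact_perturb :: 'a bop \<Rightarrow> _)"
    unfolding symp_def compact_perturb_def by (metis compact_op_uminus minus_diff_eq)
  show "transp (compact_perturb :: 'a bop \<Rightarrow> _)"
  proof (rule transpI)
    fix a b c :: "'a bop"
    assume "compact_perturb a b" "compact_perturb b c"
    then show "compact_perturb a c"
      unfolding compact_perturb_def using compact_op_add[of "a - b" "b - c"] by simp
  qed
qed

lift_definition calkin_proj :: "'a :: chilbert_space bop \<Rightarrow> 'a calkin" is "\<lambda>a. a" .

lift_definition calkin_adj :: "'a :: chilbert_space calkin \<Rightarrow> 'a calkin" is bop_adj
  unfolding compact_perturb_def by (metis bop_adj_diff compact_op_adj)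

lemma quotient_norm_cong:
  assumes "compact_op (a - b)"
  shows "{norm (a + k) |k. compact_op k} = {norm (b + k) |k. compact_op k}"
proof -
  have *: "{norm (a + k) |k. compact_op k} \<subseteq> {norm (b + k) |k. compact_op k}"
    if "compact_op (a - b)" for a b :: "'a bop"
  proof clarify
    fix k :: "'a bop" assume "compact_op k"
    then have "compact_op (a - b + k)" using that by (rule compact_op_add[rotated])
    then show "\<exists>k'. norm (a + k) = norm (b + k') \<and> compact_op k'"
      by (intro exI[of _ "a - b + k"]) simp
  qed
  have "compact_op (b - a)"
    using compact_op_uminus[OF assms] by simp
  with * assms show ?thesis by blast
qed

lemma quotient_norm_less:
  assumes "Inf {norm (a + k) |k. compact_op k} < r"
  obtains k where "compact_op k" "norm (a + k) < r"
proof -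
  have "{norm (a + k) |k. compact_op k} \<noteq> {}"
    using compact_op_zero by blast
  moreover have "bdd_below {norm (a + k) |k. compact_op k}"
    by (rule bdd_belowI[of _ 0]) auto
  ultimately show thesis
    using assms that by (auto simp: cInf_less_iff)
qed

lemma quotient_norm_le:
  assumes "compact_op k"
  shows "Inf {norm (a + k) |k. compact_op k} \<le> norm (a + k)"
  by (rule cInf_lower) (use assms in \<open>auto intro!: bdd_belowI[of _ 0]\<close>)

lemma quotient_norm_nonneg: "0 \<le> Inf {norm (a + k) |k. compact_op k}"
  by (rule cInf_greatest) (use compact_op_zero in auto)

lemma quotient_norm_scaleR_le:
  "Inf {norm (r *\<^sub>R a + k) |k. compact_op k} \<le> \<bar>r\<bar> * Inf {norm (a + k) |k. compact_op k}"
proof (cases "r = 0")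
  case True
  then show ?thesis using quotient_norm_le[OF compact_op_zero, of "r *\<^sub>R a"] by simp
next
  case False
  show ?thesis
  proof (rule field_le_epsilon)
    fix e :: real assume "e > 0"
    then have "Inf {norm (a + k) |k. compact_op k} < Inf {norm (a + k) |k. compact_op k} + e / \<bar>r\<bar>"
      using False by simp
    then obtain k where k: "compact_op k"
        "norm (a + k) < Inf {norm (a + k) |k. compact_op k} + e / \<bar>r\<bar>"
      by (rule quotient_norm_less)
    have "Inf {norm (r *\<^sub>R a + k) |k. compact_op k} \<le> norm (r *\<^sub>R a + r *\<^sub>R k)"
      by (rule quotient_norm_le[OF compact_op_scaleR[OF k(1)]])
    also have "\<dots> = \<bar>r\<bar> * norm (a + k)" by (simp flip: scaleR_add_right)
    also have "\<dots> \<le> \<bar>r\<bar> * (Inf {norm (a + k) |k. compact_op k} + e / \<bar>r\<bar>)"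
      using k(2) by (intro mult_left_mono) auto
    finally show "Inf {norm (r *\<^sub>R a + k) |k. compact_op k}
        \<le> \<bar>r\<bar> * Inf {norm (a + k) |k. compact_op k} + e"
      using False by (simp add: distrib_left)
  qed
qed

instantiation calkin :: (chilbert_space) "{complex_vector, real_normed_algebra, monoid_mult}"
begin

lift_definition zero_calkin :: "'a calkin" is 0 .
lift_definition one_calkin :: "'a calkin" is 1 .
lift_definition plus_calkin :: "'a calkin \<Rightarrow> 'a calkin \<Rightarrow> 'a calkin" is "(+)"
  unfolding compact_perturb_def by (metis add_diff_add compact_op_add)
lift_definition uminus_calkin :: "'a calkin \<Rightarrow> 'a calkin" is uminus
  unfolding compact_perturb_def by (metis compact_op_uminus minus_diff_minus)
lift_definition minus_calkin :: "'a calkin \<Rightarrow> 'a calkin \<Rightarrow> 'a calkin" is "(-)"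
proof -
  fix a b c d :: "'a bop"
  assume "compact_perturb a b" "compact_perturb c d"
  then have "compact_op ((a - b) - (c - d))"
    unfolding compact_perturb_def by (rule compact_op_diff)
  then show "compact_perturb (a - c) (b - d)"
    unfolding compact_perturb_def by (simp add: algebra_simps)
qed
lift_definition times_calkin :: "'a calkin \<Rightarrow> 'a calkin \<Rightarrow> 'a calkin" is "(*)"
proof -
  fix a b c d :: "'a bop"
  assume "compact_perturb a b" "compact_perturb c d"
  then have "compact_op ((a - b) * c + b * (c - d))"
    unfolding compact_perturb_def
    by (intro compact_op_add compact_op_mult_left compact_op_mult_right)
  then show "compact_perturb (a * c) (b * d)"
    unfolding compact_perturb_def by (simp add: algebra_simps)
qed
lift_definition scaleR_calkin :: "real \<Rightarrow> 'a calkin \<Rightarrow> 'a calkin" is "(*\<^sub>R)"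
  unfolding compact_perturb_def by (simp add: compact_op_scaleR flip: scaleR_diff_right)
lift_definition scaleC_calkin :: "complex \<Rightarrow> 'a calkin \<Rightarrow> 'a calkin" is "(*\<^sub>C)"
  unfolding compact_perturb_def
  by (simp add: compact_op_scaleC flip: complex_vector.scale_right_diff_distrib)
lift_definition norm_calkin :: "'a calkin \<Rightarrow> real" is "\<lambda>a. Inf {norm (a + k) |k. compact_op k}"
  unfolding compact_perturb_def by (simp only: quotient_norm_cong)

definition sgn_calkin :: "'a calkin \<Rightarrow> 'a calkin" where "sgn_calkin a = inverse (norm a) *\<^sub>R a"
definition dist_calkin :: "'a calkin \<Rightarrow> 'a calkin \<Rightarrow> real" where "dist_calkin a b = norm (a - b)"
definition uniformity_calkin :: "('a calkin \<times> 'a calkin) filter"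
  where "uniformity_calkin = (INF e\<in>{0 <..}. principal {(x, y). dist x y < e})"
definition open_calkin :: "'a calkin set \<Rightarrow> bool"
  where "open_calkin S = (\<forall>x\<in>S. \<forall>\<^sub>F (x', y) in uniformity. x' = x \<longrightarrow> y \<in> S)"

instance
proof
  fix a b c :: "'a calkin" and p q :: complex and r s :: real
  note [simp] = compact_perturb_def compact_op_zero
  show "a + b + c = a + (b + c)" by transfer (simp add: algebra_simps)
  show "a + b = b + a" by transfer (simp add: algebra_simps)
  show "0 + a = a" by transfer simp
  show "- a + a = 0" by transfer simp
  show "a - b = a + - b" by transfer simp
  show "r *\<^sub>R (a + b) = r *\<^sub>R a + r *\<^sub>R b" by transfer (simp add: scaleR_add_right)
  show "(r + s) *\<^sub>R a = r *\<^sub>R a + s *\<^sub>R a" by transfer (simp add: scaleR_add_left)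
  show "r *\<^sub>R s *\<^sub>R a = (r * s) *\<^sub>R a" by transfer simp
  show "1 *\<^sub>R a = a" by transfer simp
  show "p *\<^sub>C (a + b) = p *\<^sub>C a + p *\<^sub>C b" by transfer (simp add: scaleC_add_right)
  show "(p + q) *\<^sub>C a = p *\<^sub>C a + q *\<^sub>C a" by transfer (simp add: scaleC_add_left)
  show "p *\<^sub>C q *\<^sub>C a = (p * q) *\<^sub>C a" by transfer (simp add: scaleC_scaleC)
  show "complex_of_real r *\<^sub>C a = r *\<^sub>R a" by transfer (simp add: scaleC_of_real)
  show "a * b * c = a * (b * c)" by transfer (simp add: mult.assoc)
  show "(a + b) * c = a * c + b * c" by transfer (simp add: distrib_right)
  show "a * (b + c) = a * b + a * c" by transfer (simp add: distrib_left)
  show "r *\<^sub>R a * b = r *\<^sub>R (a * b)" by transfer simp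
  show "a * r *\<^sub>R b = r *\<^sub>R (a * b)" by transfer simp
  show "1 * a = a" by transfer simp
  show "a * 1 = a" by transfer simp
  show "norm a = 0 \<longleftrightarrow> a = 0"
  proof (transfer, simp only: compact_perturb_def diff_0_right, rule iffI)
    fix a :: "'a bop" assume 0: "Inf {norm (a + k) |k. compact_op k} = 0"
    show "compact_op a"
    proof (rule compact_op_limit)
      fix e :: real assume "e > 0"
      with 0 obtain k where "compact_op k" "norm (a + k) < e"
        using quotient_norm_less[of a e] by auto
      then show "\<exists>k. compact_op k \<and> norm (a - k) < e"
        by (intro exI[of _ "- k"]) (simp add: compact_op_uminus)
    qed
  next
    fix a :: "'a bop" assume "compact_op a"
    then show "Inf {norm (a + k) |k. compact_op k} = 0"
      using quotient_norm_le[OF compact_op_uminus[of a], of a] quotient_norm_nonneg[of a] by simp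
  qed
  show "norm (a + b) \<le> norm a + norm b"
  proof (transfer, rule field_le_epsilon)
    fix a b :: "'a bop" and e :: real assume "e > 0"
    let ?n = "\<lambda>a :: 'a bop. Inf {norm (a + k) |k. compact_op k}"
    obtain k where k: "compact_op k" "norm (a + k) < ?n a + e / 2"
      using quotient_norm_less[of a "?n a + e / 2"] \<open>e > 0\<close> by auto
    obtain l where l: "compact_op l" "norm (b + l) < ?n b + e / 2"
      using quotient_norm_less[of b "?n b + e / 2"] \<open>e > 0\<close> by auto
    have "?n (a + b) \<le> norm (a + b + (k + l))"
      by (rule quotient_norm_le[OF compact_op_add[OF k(1) l(1)]])
    also have "\<dots> \<le> norm (a + k) + norm (b + l)"
      using norm_triangle_ineq[of "a + k" "b + l"] by (simp add: algebra_simps)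
    finally show "?n (a + b) \<le> ?n a + ?n b + e" using k l by linarith
  qed
  show "norm (r *\<^sub>R a) = \<bar>r\<bar> * norm a"
  proof transfer
    fix r :: real and a :: "'a bop"
    let ?n = "\<lambda>a :: 'a bop. Inf {norm (a + k) |k. compact_op k}"
    show "?n (r *\<^sub>R a) = \<bar>r\<bar> * ?n a"
    proof (cases "r = 0")
      case True
      then show ?thesis
        using quotient_norm_scaleR_le[of r a] quotient_norm_nonneg[of "r *\<^sub>R a"] by simp
    next
      case False
      have "?n a \<le> \<bar>inverse r\<bar> * ?n (r *\<^sub>R a)"
        using quotient_norm_scaleR_le[of "inverse r" "r *\<^sub>R a"] False by simp
      then have "\<bar>r\<bar> * ?n a \<le> ?n (r *\<^sub>R a)"
        using False by (simp add: field_simps)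
      with quotient_norm_scaleR_le[of r a] show ?thesis by simp
    qed
  qed
  show "norm (a * b) \<le> norm a * norm b"
  proof transfer
    fix a b :: "'a bop"
    let ?n = "\<lambda>a :: 'a bop. Inf {norm (a + k) |k. compact_op k}"
    have *: "?n (a * b) \<le> x * y" if ab: "?n a < x" "?n b < y" for x y
    proof -
      obtain k where k: "compact_op k" "norm (a + k) < x" by (rule quotient_norm_less[OF ab(1)])
      obtain l where l: "compact_op l" "norm (b + l) < y" by (rule quotient_norm_less[OF ab(2)])
      have "compact_op (a * l + k * (b + l))"
        by (intro compact_op_add compact_op_mult_left[OF l(1)] compact_op_mult_right[OF k(1)])
      from quotient_norm_le[OF this]
      have "?n (a * b) \<le> norm (a * b + (a * l + k * (b + l)))" .
      also have "\<dots> = norm ((a + k) * (b + l))" by (simp add: algebra_simps)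
      also have "\<dots> \<le> norm (a + k) * norm (b + l)" by (rule norm_mult_ineq)
      also have "\<dots> \<le> x * y"
        using k(2) l(2) order_trans[OF norm_ge_zero less_imp_le[OF k(2)]]
        by (intro mult_mono) auto
      finally show ?thesis .
    qed
    have "(\<lambda>n. (?n a + 1 / real (Suc n)) * (?n b + 1 / real (Suc n))) \<longlonglongrightarrow> (?n a + 0) * (?n b + 0)"
      by (intro tendsto_intros LIMSEQ_inverse_real_of_nat[unfolded inverse_eq_divide])
    then have "?n (a * b) \<le> (?n a + 0) * (?n b + 0)"
      by (rule LIMSEQ_le_const) (intro exI allI impI *; simp)
    then show "?n (a * b) \<le> ?n a * ?n b" by simp
  qed
qed (simp_all add: sgn_calkin_def dist_calkin_def uniformity_calkin_def open_calkin_def)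

end


section \<open>Automorphisms\<close>

definition star_automorphism :: "('a :: chilbert_space calkin \<Rightarrow> 'a calkin) \<Rightarrow> bool" where
  "star_automorphism \<Phi> \<longleftrightarrow> bij \<Phi> \<and>
     (\<forall>x y. \<Phi> (x + y) = \<Phi> x + \<Phi> y) \<and>
     (\<forall>c x. \<Phi> (c *\<^sub>C x) = c *\<^sub>C \<Phi> x) \<and>
     (\<forall>x y. \<Phi> (x * y) = \<Phi> x * \<Phi> y) \<and>
     (\<forall>x. \<Phi> (calkin_adj x) = calkin_adj (\<Phi> x))"

definition calkin_unitary :: "'a :: chilbert_space calkin \<Rightarrow> bool" where
  "calkin_unitary v \<longleftrightarrow> calkin_adj v * v = 1 \<and> v * calkin_adj v = 1"

definition inner_automorphism :: "('a :: chilbert_space calkin \<Rightarrow> 'a calkin) \<Rightarrow> bool" where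
  "inner_automorphism \<Phi> \<longleftrightarrow>
     star_automorphism \<Phi> \<and> (\<exists>v. calkin_unitary v \<and> (\<forall>x. \<Phi> x = v * x * calkin_adj v))"

definition inner_on :: "('a :: chilbert_space calkin \<Rightarrow> 'a calkin) \<Rightarrow> 'a calkin set \<Rightarrow> bool" where
  "inner_on \<Phi> Y \<longleftrightarrow> (\<exists>\<Phi>'. inner_automorphism \<Phi>' \<and> (\<forall>x\<in>Y. \<Phi> x = \<Phi>' x))"

definition atomic_masa :: "(nat \<Rightarrow> 'a :: chilbert_space) \<Rightarrow> 'a bop set" where
  "atomic_masa e = {a. \<forall>n. \<exists>c. bop_apply a (e n) = c *\<^sub>C e n}"

text \<open>Subalgebras are not required to be unital, norm closed or closed under the adjoint.\<close>

definition calkin_subalgebra :: "'a :: chilbert_space calkin set \<Rightarrow> bool" where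
  "calkin_subalgebra Y \<longleftrightarrow> csubspace Y \<and> (\<forall>x\<in>Y. \<forall>y\<in>Y. x * y \<in> Y)"

text \<open>No set of reals has cardinality strictly between that of the naturals and of the reals.\<close>

definition continuum_hypothesis :: bool where
  "continuum_hypothesis \<longleftrightarrow> (\<forall>A :: real set. countable A \<or> A \<approx> (UNIV :: real set))"

end

theory Submission
  imports Defs
begin

text \<open>For a unimodular sequence \<open>\<alpha>\<close> let \<open>u \<alpha>\<close> be the diagonal unitary with entries \<open>\<alpha> n\<close>.
  Every bounded operator is, up to a compact operator, concentrated in a band
  \<open>{(i, j). j \<le> h i \<and> i \<le> h j}\<close>, and a diagonal unitary whose entries oscillate less and less
  on the intervals \<open>{i..h i}\<close> commutes with it modulo the compacts. Along a well-order of the operators,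
  whose initial segments are countable by the Continuum Hypothesis, one chooses bands \<open>h x\<close>,
  eventually increasing, and sequences \<open>\<alpha> x\<close> such that conjugation by \<open>u (\<alpha> x)\<close> agrees, on operators
  that fit into the band \<open>h y\<close> of an earlier stage, with conjugation by \<open>u (\<alpha> y)\<close>. The limit of
  these conjugations is an automorphism which is the identity on the diagonal operators and is a
  conjugation on each countable set; there is enough freedom at stage \<open>x\<close> to make it differ from
  conjugation by \<open>x\<close>.\<close>

section \<open>Slowly varying sequences\<close>

text \<open>The operators index two tasks at once: \<open>x\<close> has to be fitted into a band,
  and \<open>x\<close> is a possible lift of an implementing element that has to be defeated. A
  countable history can be absorbed because all requirements are eventual: countably many bands have
  a common eventual bound, and countably many coherent sequences can be glued with errors tending to
  zero. The freedom comes from slowness being a condition on the intervals \<open>{i..h i}\<close>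
  only. The sequence need not converge and may run round the circle forever; conjugation by it fixes
  everything in the band modulo compacts, yet moves some other operator. The band of stage
  \<open>x\<close> is enlarged to take in a witness of the disagreement after the sequence is
  chosen, so that later stages preserve it. Surjectivity rests on diagonal unitaries keeping each
  operator in its band.\<close>

definition growing :: "(nat \<Rightarrow> nat) \<Rightarrow> bool" where
  "growing h \<longleftrightarrow> mono h \<and> (\<forall>i. i < h i)"

definition dominated :: "(nat \<Rightarrow> nat) \<Rightarrow> (nat \<Rightarrow> nat) \<Rightarrow> bool" where
  "dominated h h' \<longleftrightarrow> (\<forall>\<^sub>F n in sequentially. h n \<le> h' n)"

lemma dominated_refl [simp]: "dominated h h"
  by (simp add: dominated_def)

lemma dominated_trans:
  assumes "dominated f g" "dominated g h"
  shows "dominated f h"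
  using assms unfolding dominated_def by eventually_elim simp

text \<open>A diagonal bound: \<open>h i\<close> collects all \<open>H k j\<close> with
  \<open>k \<le> i\<close> and \<open>j \<le> i\<close>, so it dominates \<open>H k\<close> from
  \<open>i = k\<close> on. Summing over \<open>j\<close> as well makes \<open>h\<close> monotone
  although the \<open>H k\<close> need not be.\<close>

lemma growing_dominating:
  fixes H :: "nat \<Rightarrow> nat \<Rightarrow> nat"
  obtains h where "growing h" "\<And>k. dominated (H k) h"
proof
  define h where "h i = Suc i + (\<Sum>k\<le>i. \<Sum>j\<le>i. H k j)" for i
  have "(\<Sum>k\<le>i. \<Sum>j\<le>i. H k j) \<le> (\<Sum>k\<le>i'. \<Sum>j\<le>i'. H k j)" if "i \<le> i'" for i i'
    by (rule order_trans[OF sum_mono sum_mono2]) (use that in \<open>auto intro!: sum_mono2\<close>)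
  then show "growing h"
    by (auto simp: growing_def h_def mono_def intro!: add_mono)
  fix k
  have "H k i \<le> h i" if "k \<le> i" for i
  proof -
    have "H k i \<le> (\<Sum>j\<le>i. H k j)" by (rule member_le_sum) auto
    also have "\<dots> \<le> (\<Sum>k\<le>i. \<Sum>j\<le>i. H k j)"
      by (rule member_le_sum[of k _ "\<lambda>k. \<Sum>j\<le>i. H k j"]) (use that in auto)
    finally show ?thesis by (simp add: h_def)
  qed
  then show "dominated (H k) h"
    unfolding dominated_def eventually_sequentially by blast
qed

definition slow :: "(nat \<Rightarrow> nat) \<Rightarrow> (nat \<Rightarrow> complex) \<Rightarrow> bool" where
  "slow h \<gamma> \<longleftrightarrow> (\<forall>\<epsilon>>0. \<forall>\<^sub>F i in sequentially. \<forall>j\<in>{i..h i}. cmod (\<gamma> i - \<gamma> j) < \<epsilon>)"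

lemma slow_const [simp]: "slow h (\<lambda>_. c)"
  by (simp add: slow_def)

lemma slow_dominated:
  assumes "slow h' \<gamma>" "dominated h h'"
  shows "slow h \<gamma>"
  unfolding slow_def
proof (intro allI impI)
  fix \<epsilon> :: real assume "\<epsilon> > 0"
  then have "\<forall>\<^sub>F i in sequentially. \<forall>j\<in>{i..h' i}. cmod (\<gamma> i - \<gamma> j) < \<epsilon>"
    using assms(1) by (simp add: slow_def)
  then show "\<forall>\<^sub>F i in sequentially. \<forall>j\<in>{i..h i}. cmod (\<gamma> i - \<gamma> j) < \<epsilon>"
    using assms(2) unfolding dominated_def by eventually_elim auto
qed

lemma slow_mult:
  assumes "slow h \<beta>" "slow h \<gamma>" and unit: "\<And>n. cmod (\<beta> n) = 1" "\<And>n. cmod (\<gamma> n) = 1"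
  shows "slow h (\<lambda>n. \<beta> n * \<gamma> n)"
  unfolding slow_def
proof (intro allI impI)
  fix \<epsilon> :: real assume "\<epsilon> > 0"
  then have "\<forall>\<^sub>F i in sequentially. \<forall>j\<in>{i..h i}. cmod (\<beta> i - \<beta> j) < \<epsilon> / 2"
    "\<forall>\<^sub>F i in sequentially. \<forall>j\<in>{i..h i}. cmod (\<gamma> i - \<gamma> j) < \<epsilon> / 2"
    using assms(1,2) half_gt_zero unfolding slow_def by blast+
  then show "\<forall>\<^sub>F i in sequentially. \<forall>j\<in>{i..h i}. cmod (\<beta> i * \<gamma> i - \<beta> j * \<gamma> j) < \<epsilon>"
  proof eventually_elim
    case (elim i)
    show ?case
    proof
      fix j assume j: "j \<in> {i..h i}"
      have "\<beta> i * \<gamma> i - \<beta> j * \<gamma> j = (\<beta> i - \<beta> j) * \<gamma> i + \<beta> j * (\<gamma> i - \<gamma> j)"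
        by (simp add: algebra_simps)
      also have "cmod \<dots> \<le> cmod (\<beta> i - \<beta> j) + cmod (\<gamma> i - \<gamma> j)"
        using norm_triangle_ineq[of "(\<beta> i - \<beta> j) * \<gamma> i" "\<beta> j * (\<gamma> i - \<gamma> j)"]
        by (simp add: norm_mult unit)
      also have "\<dots> < \<epsilon>" using elim j by fastforce
      finally show "cmod (\<beta> i * \<gamma> i - \<beta> j * \<gamma> j) < \<epsilon>" .
    qed
  qed
qed

text \<open>For unimodular sequences the product is the quotient of \<open>\<beta>\<close> by
  \<open>\<alpha>\<close>. Its slowness is what makes both diagonal unitaries conjugate an operator
  in the band \<open>h\<close> to the same operator modulo compacts.\<close>

definition coherent :: "(nat \<Rightarrow> nat) \<Rightarrow> (nat \<Rightarrow> complex) \<Rightarrow> (nat \<Rightarrow> complex) \<Rightarrow> bool" where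
  "coherent h \<alpha> \<beta> \<longleftrightarrow> slow h (\<lambda>n. \<beta> n * cnj (\<alpha> n))"

lemma unit_mult_cnj: "cmod z = 1 \<Longrightarrow> z * cnj z = 1"
  by (simp flip: complex_norm_square)

lemma coherent_refl: "(\<And>n. cmod (\<alpha> n) = 1) \<Longrightarrow> coherent h \<alpha> \<alpha>"
  by (simp add: coherent_def unit_mult_cnj)

lemma coherent_trans:
  assumes "coherent h \<alpha> \<beta>" "coherent h \<beta> \<gamma>"
    and "\<And>n. cmod (\<alpha> n) = 1" "\<And>n. cmod (\<beta> n) = 1" "\<And>n. cmod (\<gamma> n) = 1"
  shows "coherent h \<alpha> \<gamma>"
proof -
  have "slow h (\<lambda>n. (\<gamma> n * cnj (\<beta> n)) * (\<beta> n * cnj (\<alpha> n)))"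
    by (rule slow_mult) (use assms in \<open>auto simp: coherent_def norm_mult\<close>)
  moreover have "(\<gamma> n * cnj (\<beta> n)) * (\<beta> n * cnj (\<alpha> n)) = \<gamma> n * cnj (\<alpha> n)" for n
    using unit_mult_cnj[of "\<beta> n"] assms by (simp add: mult_ac)
  ultimately show ?thesis by (simp add: coherent_def)
qed

text \<open>On long intervals \<open>[m k, m (Suc k)]\<close> the limit is a constant multiple of \<open>\<alpha> k\<close>, the
  constants being chosen so that the two formulas agree at the common endpoint.\<close>

lemma coherent_limit:
  fixes \<alpha> :: "nat \<Rightarrow> nat \<Rightarrow> complex"
  assumes h: "\<And>k. growing (h k)" and \<alpha>: "\<And>k n. cmod (\<alpha> k n) = 1"
    and coh: "\<And>k l. k \<le> l \<Longrightarrow> coherent (h k) (\<alpha> k) (\<alpha> l)"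
  obtains \<beta> where "\<And>n. cmod (\<beta> n) = 1" "\<And>k. coherent (h k) (\<alpha> k) \<beta>"
proof -
  have "\<exists>M. \<forall>k\<le>l. \<forall>i\<ge>M. \<forall>j\<in>{i..h k i}.
      cmod (\<alpha> l i * cnj (\<alpha> k i) - \<alpha> l j * cnj (\<alpha> k j)) < (1/2) ^ l" for l
  proof -
    have "\<forall>\<^sub>F i in sequentially. \<forall>k\<in>{..l}. \<forall>j\<in>{i..h k i}.
        cmod (\<alpha> l i * cnj (\<alpha> k i) - \<alpha> l j * cnj (\<alpha> k j)) < (1/2) ^ l"
      using coh unfolding coherent_def slow_def by (intro eventually_ball_finite) auto
    then show ?thesis unfolding eventually_sequentially by fastforce
  qed
  then obtain M where M: "\<And>l k i j. k \<le> l \<Longrightarrow> i \<ge> M l \<Longrightarrow> j \<in> {i..h k i} \<Longrightarrow>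
      cmod (\<alpha> l i * cnj (\<alpha> k i) - \<alpha> l j * cnj (\<alpha> k j)) < (1/2) ^ l"
    by metis
  \<comment> \<open>The summand \<open>M (Suc l)\<close> puts the interval starting at
    \<open>m (Suc l)\<close> into the range where the estimate for index \<open>Suc l\<close> holds.
    The sum over \<open>k\<close> makes the intervals so long that \<open>{i..h k i}\<close> crosses
    at most one breakpoint once \<open>k\<close> is at most the index of the interval. Since
    \<open>m 0 = 0\<close> ignores \<open>M 0\<close>, index 0 is excluded in
    \<open>m_M\<close>.\<close>
  define m where "m = rec_nat 0 (\<lambda>l p. Suc (p + M (Suc l) + (\<Sum>k\<le>l. h k p)))"
  have m_0: "m 0 = 0" by (simp add: m_def)
  have m_Suc: "m (Suc l) = Suc (m l + M (Suc l) + (\<Sum>k\<le>l. h k (m l)))" for l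
    by (simp add: m_def)
  have m_M: "M l \<le> m l" if "l > 0" for l
    using that by (cases l) (auto simp: m_Suc)
  have m_h: "h k (m l) \<le> m (Suc l)" if "k \<le> l" for k l
    using member_le_sum[of k "{..l}" "\<lambda>k. h k (m l)"] that by (simp add: m_Suc)
  have m_sm: "strict_mono m" by (rule strict_monoI_Suc) (simp add: m_Suc)
  have m_ge: "k \<le> m k" for k using m_sm by (rule strict_mono_imp_increasing)
  define c where "c = rec_nat 1 (\<lambda>l z. z * \<alpha> l (m (Suc l)) * cnj (\<alpha> (Suc l) (m (Suc l))))"
  have c_Suc: "c (Suc l) = c l * \<alpha> l (m (Suc l)) * cnj (\<alpha> (Suc l) (m (Suc l)))" for l
    by (simp add: c_def)
  have c_unit: "cmod (c l) = 1" for l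
    by (induction l) (simp_all add: c_Suc norm_mult \<alpha>, simp add: c_def)
  define L where "L i = (LEAST l. i < m (Suc l))" for i
  have L: "i < m (Suc (L i))" for i
    unfolding L_def by (rule LeastI_ex) (use m_ge[of "Suc i"] in \<open>auto intro: exI[of _ i]\<close>)
  have L': "m (L i) \<le> i" for i
  proof (cases "L i")
    case (Suc l)
    then have "\<not> i < m (Suc l)" using not_less_Least[of l "\<lambda>l. i < m (Suc l)"] by (simp add: L_def)
    then show ?thesis using Suc by simp
  qed (simp add: m_0)
  define \<beta> where "\<beta> i = c (L i) * \<alpha> (L i) i" for i
  \<comment> \<open>Both ends are included: at \<open>m (Suc l)\<close> the definition of
    \<open>\<beta>\<close> already uses index \<open>Suc l\<close>, and the choice of
    \<open>c\<close> makes index \<open>l\<close> give the same value. Hence a step across the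
    breakpoint can be split there.\<close>
  have \<beta>_eq: "\<beta> i = c l * \<alpha> l i" if "m l \<le> i" "i \<le> m (Suc l)" for i l
  proof (cases "i < m (Suc l)")
    case True
    have "L i < Suc l" using L'[of i] True m_sm by (meson le_less_trans strict_mono_less)
    moreover have "l < Suc (L i)" using L[of i] that m_sm by (meson le_less_trans strict_mono_less)
    ultimately have "L i = l" by simp
    then show ?thesis by (simp add: \<beta>_def)
  next
    case False
    then have i: "i = m (Suc l)" using that by simp
    have "L i < Suc (Suc l)" using L'[of i] i m_sm by (simp add: strict_mono_less_eq)
    moreover have "Suc l < Suc (L i)" using L[of i] i m_sm by (simp add: strict_mono_less)
    ultimately have "L i = Suc l" by simp
    then show ?thesis
      using unit_mult_cnj[OF \<alpha>, of "Suc l" i] i by (simp add: \<beta>_def c_Suc mult_ac)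
  qed
  have unit: "cmod (\<beta> n) = 1" for n by (simp add: \<beta>_def norm_mult \<alpha> c_unit)
  have "coherent (h k) (\<alpha> k) \<beta>" for k
    unfolding coherent_def slow_def
  proof (intro allI impI)
    fix \<epsilon> :: real assume "\<epsilon> > 0"
    then obtain K where "(1/2) ^ K < \<epsilon> / 2"
      using real_arch_pow_inv[of "\<epsilon> / 2" "1/2"] by auto
    define K' where "K' = Suc (max k K)"
    have K': "k \<le> K'" "K' > 0" by (auto simp: K'_def)
    have "(1/2 :: real) ^ K' \<le> (1/2) ^ K" by (intro power_decreasing) (auto simp: K'_def)
    then have \<epsilon>: "(1/2) ^ K' < \<epsilon> / 2" using \<open>(1/2) ^ K < \<epsilon> / 2\<close> by linarith
    define \<gamma> where "\<gamma> n = \<beta> n * cnj (\<alpha> k n)" for n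
    have seg: "cmod (\<gamma> i - \<gamma> j) < \<epsilon> / 2"
      if "l \<ge> K'" "m l \<le> i" "i \<le> j" "j \<le> m (Suc l)" "j \<le> h k i" for i j l
    proof -
      have "\<gamma> i - \<gamma> j = c l * (\<alpha> l i * cnj (\<alpha> k i) - \<alpha> l j * cnj (\<alpha> k j))"
        using \<beta>_eq[of l i] \<beta>_eq[of l j] that by (simp add: \<gamma>_def algebra_simps)
      then have "cmod (\<gamma> i - \<gamma> j) = cmod (\<alpha> l i * cnj (\<alpha> k i) - \<alpha> l j * cnj (\<alpha> k j))"
        by (simp add: norm_mult c_unit)
      also have "\<dots> < (1/2) ^ l"
        using that K' m_M[of l] by (intro M) auto
      also have "\<dots> \<le> (1/2) ^ K'" using that by (intro power_decreasing) auto
      finally show ?thesis using \<epsilon> by simp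
    qed
    have "cmod (\<gamma> i - \<gamma> j) < \<epsilon>" if i: "i \<ge> m K'" and j: "j \<in> {i..h k i}" for i j
    proof -
      let ?l = "L i"
      have "K' < Suc ?l" using L[of i] i m_sm by (meson le_less_trans strict_mono_less)
      then have l: "K' \<le> ?l" by simp
      show ?thesis
      proof (cases "j \<le> m (Suc ?l)")
        case True
        then show ?thesis using seg[OF l L'[of i], of j] j \<open>\<epsilon> > 0\<close> by simp
      next
        case False
        let ?p = "m (Suc ?l)"
        \<comment> \<open>The interval crosses the breakpoint \<open>?p\<close>. Monotonicity of
          \<open>h k\<close> gives \<open>j \<le> h k ?p\<close>, which does not exceed the next
          breakpoint, so two estimates by \<open>\<epsilon> / 2\<close> suffice.\<close>
        have hp: "h k i \<le> h k ?p" using h[of k] L[of i] by (simp add: growing_def mono_def)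
        have "cmod (\<gamma> i - \<gamma> ?p) < \<epsilon> / 2"
          using seg[OF l L'[of i], of ?p] L[of i] j False by simp
        moreover have "cmod (\<gamma> ?p - \<gamma> j) < \<epsilon> / 2"
        proof (rule seg[of "Suc ?l"])
          show "j \<le> m (Suc (Suc ?l))" using m_h[of k "Suc ?l"] hp j l K' by simp
        qed (use l j hp False in auto)
        ultimately show ?thesis
          using norm_triangle_ineq[of "\<gamma> i - \<gamma> ?p" "\<gamma> ?p - \<gamma> j"] by simp
      qed
    qed
    then show "\<forall>\<^sub>F i in sequentially. \<forall>j\<in>{i..h k i}.
        cmod (\<beta> i * cnj (\<alpha> k i) - \<beta> j * cnj (\<alpha> k j)) < \<epsilon>"
      unfolding eventually_sequentially \<gamma>_def by blast
  qed
  with unit that show thesis by blast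
qed

text \<open>The iterates of \<open>h\<close> at 0 cut the indices into blocks, numbered by
  \<open>K\<close>. Square roots tend to infinity with increments tending to zero, so
  \<open>cis (pi * sqrt (real (K i)))\<close> runs round the circle forever in ever smaller steps.
  At the start of block \<open>m\<^sup>2\<close> the value is \<open>(-1) ^ m\<close>; even
  \<open>m\<close> give \<open>p\<close>, odd \<open>m\<close> give \<open>q\<close>.\<close>

lemma alternating_slow:
  assumes "growing h"
  obtains \<beta> and p q :: "nat \<Rightarrow> nat" where "slow h \<beta>" "\<And>n. cmod (\<beta> n) = 1"
    "inj p" "inj q" "\<And>k. \<beta> (p k) = 1" "\<And>k. \<beta> (q k) = -1"
proof -
  define n where "n k = (h ^^ k) 0" for k
  have n_Suc: "n (Suc k) = h (n k)" for k by (simp add: n_def)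
  have n_sm: "strict_mono n"
    by (rule strict_monoI_Suc) (use assms in \<open>simp add: n_Suc growing_def\<close>)
  have n_ge: "k \<le> n k" for k using n_sm by (rule strict_mono_imp_increasing)
  define K where "K i = (LEAST k. i < n (Suc k))" for i
  have K: "i < n (Suc (K i))" for i
    unfolding K_def by (rule LeastI_ex) (use n_ge[of "Suc i"] in \<open>auto intro: exI[of _ i]\<close>)
  have K': "n (K i) \<le> i" for i
  proof (cases "K i")
    case (Suc k)
    then have "\<not> i < n (Suc k)" using not_less_Least[of k "\<lambda>k. i < n (Suc k)"] by (simp add: K_def)
    then show ?thesis using Suc by simp
  qed (simp add: n_def)
  have K_n: "K (n k) = k" for k
    using K[of "n k"] K'[of "n k"] n_sm by (simp add: strict_mono_less strict_mono_less_eq)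
  define \<beta> where "\<beta> i = cis (pi * sqrt (real (K i)))" for i
  have \<beta>_sq: "\<beta> (n (m\<^sup>2)) = (-1) ^ m" for m
    using Complex.DeMoivre[of pi m, unfolded cis_pi, symmetric] by (simp add: \<beta>_def K_n mult.commute[of pi])
  show thesis
  proof (rule that[of \<beta> "\<lambda>k. n ((2 * k)\<^sup>2)" "\<lambda>k. n ((2 * k + 1)\<^sup>2)"])
    show "cmod (\<beta> i) = 1" for i by (simp add: \<beta>_def)
    show "inj (\<lambda>k. n ((2 * k)\<^sup>2))" "inj (\<lambda>k. n ((2 * k + 1)\<^sup>2))"
      unfolding inj_on_def strict_mono_eq[OF n_sm] by (simp_all add: power2_eq_iff_nonneg)
    show "\<beta> (n ((2 * k)\<^sup>2)) = 1" "\<beta> (n ((2 * k + 1)\<^sup>2)) = -1" for k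
      unfolding \<beta>_sq by simp_all
    show "slow h \<beta>"
      unfolding slow_def
    proof (intro allI impI)
      fix \<epsilon> :: real assume \<epsilon>: "\<epsilon> > 0"
      define \<delta> where "\<delta> = \<epsilon> / (2 * pi)"
      have \<delta>: "\<delta> > 0" using \<epsilon> by (simp add: \<delta>_def)
      obtain k0 where k0: "1 / \<delta>\<^sup>2 < real k0" using reals_Archimedean2 by blast
      have step: "sqrt (real (k + 2)) \<le> sqrt (real k) + \<delta>" if "k0 \<le> k" for k
      proof (rule real_le_lsqrt)
        have "(1 / \<delta>)\<^sup>2 \<le> real k" using k0 that by (simp add: power_divide)
        then have "1 / \<delta> \<le> sqrt (real k)" by (rule real_le_rsqrt)
        then have "1 \<le> \<delta> * sqrt (real k)" using \<delta> by (simp add: field_simps)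
        moreover have "(sqrt (real k) + \<delta>)\<^sup>2 = real k + 2 * (\<delta> * sqrt (real k)) + \<delta>\<^sup>2"
          by (simp add: power2_sum)
        ultimately have "real k + 2 \<le> (sqrt (real k) + \<delta>)\<^sup>2"
          using zero_le_power2[of \<delta>] by linarith
        then show "real (k + 2) \<le> (sqrt (real k) + \<delta>)\<^sup>2" by simp
      qed (use \<delta> in auto)
      have "cmod (\<beta> i - \<beta> j) < \<epsilon>" if i: "i \<ge> n k0" and j: "j \<in> {i..h i}" for i j
      proof -
        have "k0 < Suc (K i)" using K[of i] i n_sm by (meson le_less_trans strict_mono_less)
        moreover have Kij: "K i \<le> K j"
        proof -
          have "n (K i) < n (Suc (K j))" using K'[of i] K[of j] j by simp
          then show ?thesis using n_sm by (simp add: strict_mono_less)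
        qed
        \<comment> \<open>As \<open>h\<close> is only weakly monotone, \<open>h i\<close> may reach
          the starting point \<open>n (Suc (Suc (K i)))\<close> itself; this is why
          \<open>step\<close> treats an increment of 2.\<close>
        moreover have "K j \<le> K i + 2"
        proof -
          have "h i \<le> h (n (Suc (K i)))" using assms K[of i] by (simp add: growing_def mono_def)
          then have "n (K j) \<le> n (Suc (Suc (K i)))" using K'[of j] j by (simp add: n_Suc)
          then show ?thesis using n_sm by (simp add: strict_mono_less_eq)
        qed
        ultimately have "sqrt (real (K j)) \<le> sqrt (real (K i)) + \<delta>" "sqrt (real (K i)) \<le> sqrt (real (K j))"
          using order_trans[OF _ step[of "K i"], of "sqrt (real (K j))"] by simp_all
        then have "pi * \<bar>sqrt (real (K i)) - sqrt (real (K j))\<bar> \<le> pi * \<delta>"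
          by (intro mult_left_mono) auto
        moreover have "cmod (cis s - cis t) \<le> \<bar>s - t\<bar>" for s t
        proof -
          have "cis s - cis t = cis t * (cis (s - t) - 1)"
            by (simp add: right_diff_distrib cis_mult)
          then have "cmod (cis s - cis t) = cmod (cis (s - t) - 1)"
            by (simp only: norm_mult norm_cis mult_1_left)
          also have "\<dots> = cmod (exp (\<i> * complex_of_real (s - t)) - 1)"
            by (simp only: cis_conv_exp)
          also have "\<dots> = 2 * \<bar>sin ((s - t) / 2)\<bar>" by (rule dist_exp_i_1)
          finally show ?thesis using abs_sin_x_le_abs_x[of "(s - t) / 2"] by simp
        qed
        from this[of "pi * sqrt (real (K i))" "pi * sqrt (real (K j))"]
        have "cmod (\<beta> i - \<beta> j) \<le> pi * \<bar>sqrt (real (K i)) - sqrt (real (K j))\<bar>"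
          by (simp add: \<beta>_def abs_mult flip: right_diff_distrib)
        ultimately have "cmod (\<beta> i - \<beta> j) \<le> pi * \<delta>" by (rule order_trans[rotated])
        then show ?thesis using \<epsilon> by (simp add: \<delta>_def)
      qed
      then show "\<forall>\<^sub>F i in sequentially. \<forall>j\<in>{i..h i}. cmod (\<beta> i - \<beta> j) < \<epsilon>"
        unfolding eventually_sequentially by blast
    qed
  qed
qed

section \<open>Coordinates with respect to an orthonormal basis\<close>

lemma cmod_cinner_le: "cmod (cinner x y) \<le> norm x * norm (y :: 'a :: chilbert_space)"
proof (cases "cinner x y = 0")
  case False
  define c where "c = cnj (cinner x y) / cmod (cinner x y)"
  have "c * cinner x y = cmod (cinner x y)"
    using False by (simp add: c_def field_simps flip: complex_norm_square)
      (simp add: power2_eq_square)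
  then have "cmod (cinner x y) = Re (cinner (c *\<^sub>C x) y)"
    by (simp add: cinner_scaleC_left)
  also have "\<dots> \<le> norm (c *\<^sub>C x) * norm y" by (rule Re_cinner_le)
  also have "norm (c *\<^sub>C x) = norm x"
    using False by (simp add: norm_scaleC c_def norm_divide)
  finally show ?thesis .
qed auto

lemma bounded_linear_cinner_left: "bounded_linear (\<lambda>x. cinner x (y :: 'a :: chilbert_space))"
  by (rule bounded_linear_intro[of _ "norm y"])
    (auto simp: cinner_add_left cinner_scaleR_left scaleR_conv_of_real cmod_cinner_le)

lemma cinner_sum_left: "cinner (sum f F) (y :: 'a :: chilbert_space) = (\<Sum>i\<in>F. cinner (f i) y)"
  by (rule linear_sum) (rule bounded_linear.linear[OF bounded_linear_cinner_left])

section \<open>Bounded operators and their adjoints\<close>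

lemma bop_exists:
  fixes f :: "'a :: chilbert_space \<Rightarrow> 'a"
  assumes "\<And>x y. f (x + y) = f x + f y" "\<And>c x. f (c *\<^sub>C x) = c *\<^sub>C f x"
    and "\<And>x. norm (f x) \<le> B * norm x"
  obtains a where "bop_apply a = f"
proof -
  have "bounded_linear f"
    by (rule bounded_linear_intro[of _ B])
      (use assms in \<open>auto simp: mult.commute simp flip: scaleC_of_real\<close>)
  then have "bop_apply (Abs_bop (Blinfun f)) = f"
    by (simp add: bop_apply.rep_eq Abs_bop_inverse bounded_linear_Blinfun_apply assms)
  then show thesis by (rule that)
qed

lemma norm_bop_le:
  assumes "B \<ge> 0" "\<And>x. norm (bop_apply a x) \<le> B * norm x"
  shows "norm a \<le> B"
  unfolding norm_bop.rep_eq
  by (rule norm_blinfun_bound) (use assms in \<open>auto simp: bop_apply.rep_eq\<close>)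

lemma bop_adjI:
  assumes "\<And>x y. cinner (bop_apply a x) y = cinner x (bop_apply b y)"
  shows "bop_adj a = b"
  by (intro bop_eqI cinner_eqI) (simp add: assms flip: cinner_bop_adj)

lemma bop_adj_mult: "bop_adj (a * b) = bop_adj b * bop_adj a"
  by (rule bop_adjI) (simp add: cinner_bop_adj)

lemma bop_adj_adj: "bop_adj (bop_adj a) = a"
  by (rule bop_adjI) (metis cinner_bop_adj cinner_commute)

lemma norm_bop_adj: "norm (bop_adj a) = norm (a :: 'a :: chilbert_space bop)"
proof -
  have le: "norm (bop_adj a) \<le> norm a" for a :: "'a bop"
  proof (rule norm_bop_le)
    fix y
    let ?z = "bop_apply (bop_adj a) y"
    have "(norm ?z)\<^sup>2 = Re (cinner (bop_apply a ?z) y)"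
      by (simp add: power2_norm_eq_Re_cinner cinner_bop_adj)
    also have "\<dots> \<le> norm (bop_apply a ?z) * norm y" by (rule Re_cinner_le)
    also have "\<dots> \<le> (norm a * norm ?z) * norm y"
      by (intro mult_right_mono norm_bop_apply) simp
    finally have "norm ?z * norm ?z \<le> norm ?z * (norm a * norm y)"
      by (simp add: power2_eq_square mult_ac)
    then show "norm ?z \<le> norm a * norm y"
      by (cases "norm ?z = 0") (auto simp: mult_le_cancel_left)
  qed simp
  show ?thesis
    using le[of a] le[of "bop_adj a"] by (simp add: bop_adj_adj)
qed

locale onb =
  fixes e :: "nat \<Rightarrow> 'h :: chilbert_space"
  assumes e_basis: "orthonormal_basis e"
begin

definition coef :: "'h \<Rightarrow> nat \<Rightarrow> complex" where
  "coef x n = cinner x (e n)"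

lemma coef_simps [simp]:
  "coef (x + y) n = coef x n + coef y n"
  "coef (x - y) n = coef x n - coef y n"
  "coef (c *\<^sub>C x) n = c * coef x n"
  "coef (e m) n = (if m = n then 1 else 0)"
  "coef 0 n = 0"
  using e_basis cinner_diff_left[of 0 0 "e n"] unfolding coef_def orthonormal_basis_def
  by (auto simp: cinner_add_left cinner_diff_left cinner_scaleC_left)

lemma norm_e [simp]: "norm (e n) = 1"
  using coef_simps(4)[of n n] unfolding norm_eq_sqrt_cinner coef_def by simp

lemma coef_sum: "coef (\<Sum>i\<in>F. f i) n = (\<Sum>i\<in>F. coef (f i) n)"
  unfolding coef_def by (rule cinner_sum_left)

text \<open>Being orthogonal to the span of the basis, \<open>x\<close> has distance at least
  \<open>norm x\<close> from each vector of the span; density of the span then forces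
  \<open>norm x = 0\<close>.\<close>

lemma coef_eq_0_imp:
  assumes "\<And>n. coef x n = 0"
  shows "x = 0"
proof -
  have orth: "cinner x y = 0" if "y \<in> cspan (range e)" for y
    using that
  proof (induction rule: complex_vector.span_induct_alt)
    case base
    then show ?case using cinner_diff_right[of x 0 0] by simp
  next
    case (step c z y)
    then show ?case using assms by (auto simp: cinner_add_right cinner_scaleC_right coef_def)
  qed
  have le: "norm x \<le> dist y x" if "y \<in> cspan (range e)" for y
  proof -
    have "norm x * norm x = Re (cinner x (x - y))"
      by (simp add: cinner_diff_right orth[OF that] flip: power2_norm_eq_Re_cinner power2_eq_square)
    also have "\<dots> \<le> norm x * norm (x - y)" by (rule Re_cinner_le)
    finally show ?thesis
      by (cases "x = 0") (auto simp: mult_le_cancel_left dist_norm norm_minus_commute)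
  qed
  have "x \<in> closure (cspan (range e))"
    using e_basis by (simp add: orthonormal_basis_def)
  then have "\<exists>y\<in>cspan (range e). dist y x < \<epsilon>" if "\<epsilon> > 0" for \<epsilon>
    using that by (auto simp: closure_approachable)
  then have "norm x < \<epsilon>" if "\<epsilon> > 0" for \<epsilon>
    using le that by fastforce
  then have "norm x \<le> 0" by (meson less_irrefl not_le)
  then show ?thesis by simp
qed

lemma coef_eqI: "(\<And>n. coef x n = coef y n) \<Longrightarrow> x = y"
  using coef_eq_0_imp[of "x - y"] by simp

lemma norm_sum_e:
  assumes "finite F"
  shows "(norm (\<Sum>n\<in>F. c n *\<^sub>C e n))\<^sup>2 = (\<Sum>n\<in>F. (cmod (c n))\<^sup>2)"
  using assms
proof induction
  case (insert m F)
  let ?s = "\<Sum>n\<in>F. c n *\<^sub>C e n"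
  have "coef ?s m = 0"
    using insert.hyps by (auto simp: coef_sum intro!: sum.neutral)
  then have "cinner ?s (c m *\<^sub>C e m) = 0"
    by (simp add: cinner_scaleC_right coef_def)
  then have "Re (cinner (c m *\<^sub>C e m) ?s) = 0"
    using Re_cinner_commute[of ?s "c m *\<^sub>C e m"] by simp
  then show ?case
    using insert by (simp add: norm_add_square norm_scaleC)
qed simp

lemma Riesz_Fischer:
  assumes "summable (\<lambda>n. (cmod (c n))\<^sup>2)"
  shows "(\<lambda>n. c n *\<^sub>C e n) sums (\<Sum>n. c n *\<^sub>C e n)"
    and "coef (\<Sum>n. c n *\<^sub>C e n) m = c m"
    and "(\<lambda>n. (cmod (c n))\<^sup>2) sums (norm (\<Sum>n. c n *\<^sub>C e n))\<^sup>2"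
proof -
  have "summable (\<lambda>n. c n *\<^sub>C e n)"
    unfolding summable_Cauchy
  proof (intro allI impI)
    fix \<epsilon> :: real assume \<epsilon>: "\<epsilon> > 0"
    then obtain N where N: "\<And>m n. m \<ge> N \<Longrightarrow> norm (\<Sum>n=m..<n. (cmod (c n))\<^sup>2) < \<epsilon>\<^sup>2"
      using assms unfolding summable_Cauchy by (meson zero_less_power)
    have "norm (\<Sum>n=m..<n. c n *\<^sub>C e n) < \<epsilon>" if "m \<ge> N" for m n
    proof -
      have "(norm (\<Sum>n=m..<n. c n *\<^sub>C e n))\<^sup>2 < \<epsilon>\<^sup>2"
        using N[OF that, of n] by (simp add: norm_sum_e)
      then show ?thesis using \<epsilon> by (simp add: power2_less_imp_less)
    qed
    then show "\<exists>N. \<forall>m\<ge>N. \<forall>n. norm (\<Sum>n=m..<n. c n *\<^sub>C e n) < \<epsilon>" by blast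
  qed
  then show sums: "(\<lambda>n. c n *\<^sub>C e n) sums (\<Sum>n. c n *\<^sub>C e n)"
    by (rule summable_sums)
  have "(\<lambda>n. coef (c n *\<^sub>C e n) m) sums coef (\<Sum>n. c n *\<^sub>C e n) m"
    unfolding coef_def by (rule bounded_linear.sums[OF bounded_linear_cinner_left sums])
  moreover have "(\<lambda>n. coef (c n *\<^sub>C e n) m) sums c m"
  proof -
    have "(\<lambda>n. coef (c n *\<^sub>C e n) m) = (\<lambda>n. if n = m then c n else 0)" by auto
    then show ?thesis using sums_single[of m c] by simp
  qed
  ultimately show "coef (\<Sum>n. c n *\<^sub>C e n) m = c m"
    using sums_unique2 by blast
  have "(\<lambda>N. (norm (\<Sum>n<N. c n *\<^sub>C e n))\<^sup>2) \<longlonglongrightarrow> (norm (\<Sum>n. c n *\<^sub>C e n))\<^sup>2"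
    using sums unfolding sums_def by (intro tendsto_intros)
  then show "(\<lambda>n. (cmod (c n))\<^sup>2) sums (norm (\<Sum>n. c n *\<^sub>C e n))\<^sup>2"
    by (simp add: sums_def norm_sum_e)
qed

lemma Bessel:
  assumes "finite F"
  shows "(\<Sum>n\<in>F. (cmod (coef x n))\<^sup>2) \<le> (norm x)\<^sup>2"
proof -
  let ?s = "\<Sum>n\<in>F. coef x n *\<^sub>C e n"
  have "cinner ?s x = (\<Sum>n\<in>F. of_real ((cmod (coef x n))\<^sup>2))"
    unfolding cinner_sum_left
  proof (rule sum.cong[OF refl])
    fix n
    have "cinner (e n) x = cnj (coef x n)" by (simp add: coef_def flip: cinner_commute)
    then show "cinner (coef x n *\<^sub>C e n) x = of_real ((cmod (coef x n))\<^sup>2)"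
      by (simp only: cinner_scaleC_left complex_norm_square)
  qed
  then have "Re (cinner x ?s) = (\<Sum>n\<in>F. (cmod (coef x n))\<^sup>2)"
    using Re_cinner_commute[of x ?s] by simp
  then have "(norm (x - ?s))\<^sup>2 = (norm x)\<^sup>2 - (\<Sum>n\<in>F. (cmod (coef x n))\<^sup>2)"
    by (simp add: norm_diff_square norm_sum_e[OF assms])
  then show ?thesis using zero_le_power2[of "norm (x - ?s)"] by linarith
qed

lemma summable_coef: "summable (\<lambda>n. (cmod (coef x n))\<^sup>2)"
  by (rule summableI_nonneg_bounded[of _ "(norm x)\<^sup>2"]) (auto intro: Bessel)

lemma expansion: "(\<lambda>n. coef x n *\<^sub>C e n) sums x"
  and Parseval: "(\<lambda>n. (cmod (coef x n))\<^sup>2) sums (norm x)\<^sup>2"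
proof -
  have "(\<Sum>n. coef x n *\<^sub>C e n) = x"
    by (rule coef_eqI) (rule Riesz_Fischer(2)[OF summable_coef])
  then show "(\<lambda>n. coef x n *\<^sub>C e n) sums x" "(\<lambda>n. (cmod (coef x n))\<^sup>2) sums (norm x)\<^sup>2"
    using Riesz_Fischer(1,3)[OF summable_coef[of x]] by simp_all
qed

text \<open>Injectivity of \<open>\<sigma>\<close> on the support of \<open>g\<close> makes \<open>wop g \<sigma>\<close> bounded; for other arguments
  and for unbounded \<open>g\<close> it is an unspecified operator.\<close>

definition wop :: "(nat \<Rightarrow> complex) \<Rightarrow> (nat \<Rightarrow> nat) \<Rightarrow> 'h bop" where
  "wop g \<sigma> = (SOME a. \<forall>x n. coef (bop_apply a x) n = g n * coef x (\<sigma> n))"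

lemma coef_wop:
  assumes g: "\<And>n. cmod (g n) \<le> B" and inj: "inj_on \<sigma> {n. g n \<noteq> 0}"
  shows "coef (bop_apply (wop g \<sigma>) x) n = g n * coef x (\<sigma> n)"
proof -
  have B: "B \<ge> 0" using g[of 0] norm_ge_zero[of "g 0"] by linarith
  have bd: "(\<Sum>n\<in>F. (cmod (g n * coef x (\<sigma> n)))\<^sup>2) \<le> (B * norm x)\<^sup>2" if F: "finite F" for F x
  proof -
    let ?G = "F \<inter> {n. g n \<noteq> 0}"
    have "(\<Sum>n\<in>F. (cmod (g n * coef x (\<sigma> n)))\<^sup>2) = (\<Sum>n\<in>?G. (cmod (g n * coef x (\<sigma> n)))\<^sup>2)"
      by (rule sum.mono_neutral_right) (use F in auto)
    also have "\<dots> \<le> (\<Sum>n\<in>?G. B\<^sup>2 * (cmod (coef x (\<sigma> n)))\<^sup>2)"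
      by (intro sum_mono) (auto simp: norm_mult power_mult_distrib intro!: mult_right_mono power_mono g)
    also have "\<dots> = B\<^sup>2 * (\<Sum>n\<in>\<sigma> ` ?G. (cmod (coef x n))\<^sup>2)"
    proof -
      have "inj_on \<sigma> ?G" using inj by (rule inj_on_subset) auto
      then show ?thesis by (simp add: sum.reindex sum_distrib_left)
    qed
    also have "\<dots> \<le> B\<^sup>2 * (norm x)\<^sup>2"
      by (intro mult_left_mono Bessel) (use F in auto)
    finally show ?thesis by (simp add: power_mult_distrib)
  qed
  have summ: "summable (\<lambda>n. (cmod (g n * coef x (\<sigma> n)))\<^sup>2)" for x
    by (rule summableI_nonneg_bounded[of _ "(B * norm x)\<^sup>2"]) (auto intro: bd)
  define f where "f x = (\<Sum>n. (g n * coef x (\<sigma> n)) *\<^sub>C e n)" for x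
  have f: "coef (f x) n = g n * coef x (\<sigma> n)" for x n
    unfolding f_def by (rule Riesz_Fischer(2)[OF summ])
  have nf: "norm (f x) \<le> B * norm x" for x
  proof (rule power2_le_imp_le)
    show "(norm (f x))\<^sup>2 \<le> (B * norm x)\<^sup>2"
      unfolding f_def sums_unique[OF Riesz_Fischer(3)[OF summ]]
      by (rule suminf_le_const[OF summ]) (auto intro: bd)
  qed (use B in simp)
  obtain a where "bop_apply a = f"
    by (rule bop_exists[of f B])
      (auto intro!: coef_eqI nf simp: f algebra_simps)
  then have "\<exists>a. \<forall>x n. coef (bop_apply a x) n = g n * coef x (\<sigma> n)"
    using f by metis
  from someI_ex[OF this] show ?thesis unfolding wop_def by blast
qed

lemma bop_coef_eqI:
  "(\<And>x n. coef (bop_apply a x) n = coef (bop_apply b x) n) \<Longrightarrow> a = b"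
  by (intro bop_eqI coef_eqI)

end

section \<open>Diagonal operators and bands\<close>

lemma bop_apply_diff: "bop_apply a (x - y) = bop_apply a x - bop_apply a y"
  by (rule bounded_linear.linear[OF bop_apply_bounded_linear, THEN linear_diff])

lemma norm_mult3_le:
  fixes a b c :: "'a :: real_normed_algebra"
  assumes "norm a \<le> 1" "norm c \<le> 1"
  shows "norm (a * b * c) \<le> norm b"
proof -
  have "norm (a * b * c) \<le> norm (a * b) * norm c" by (rule norm_mult_ineq)
  also have "\<dots> \<le> norm a * norm b * norm c" by (intro mult_right_mono norm_mult_ineq) auto
  also have "\<dots> \<le> 1 * norm b * 1" using assms by (intro mult_mono) auto
  finally show ?thesis by simp
qed

lemma sum_intervals:
  fixes f :: "nat \<Rightarrow> 'a :: comm_monoid_add"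
  assumes "mono n"
  shows "(\<Sum>k<L. sum f {n k..<n (Suc k)}) = sum f {n 0..<n L}"
proof (induction L)
  case (Suc L)
  have "n 0 \<le> n L" "n L \<le> n (Suc L)" using assms by (auto simp: mono_def)
  then show ?case using Suc by (simp add: sum.atLeastLessThan_concat)
qed simp

context onb
begin

definition diag :: "(nat \<Rightarrow> complex) \<Rightarrow> 'h bop" where
  "diag f = wop f id"

definition proj :: "nat set \<Rightarrow> 'h bop" where
  "proj S = diag (indicator S)"

lemma coef_diag: "(\<And>n. cmod (f n) \<le> B) \<Longrightarrow> coef (bop_apply (diag f) x) n = f n * coef x n"
  unfolding diag_def by (subst coef_wop) auto

lemma coef_diag_unit [simp]:
  "(\<And>n. cmod (f n) = 1) \<Longrightarrow> coef (bop_apply (diag f) x) n = f n * coef x n"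
  by (rule coef_diag[of _ 1]) simp

lemma coef_proj [simp]: "coef (bop_apply (proj S) x) n = (if n \<in> S then coef x n else 0)"
  unfolding proj_def by (subst coef_diag[of _ 1]) (auto simp: indicator_def)

lemma cinner_sums: "(\<lambda>n. coef x n * cnj (coef y n)) sums cinner x y"
proof -
  have "(\<lambda>n. cinner (coef x n *\<^sub>C e n) y) sums cinner x y"
    by (rule bounded_linear.sums[OF bounded_linear_cinner_left expansion])
  moreover have "cinner (e n) y = cnj (coef y n)" for n
    by (simp only: coef_def flip: cinner_commute)
  ultimately show ?thesis by (simp add: cinner_scaleC_left)
qed

lemma bop_adj_diag:
  assumes "\<And>n. cmod (f n) \<le> B"
  shows "bop_adj (diag f) = diag (\<lambda>n. cnj (f n))"
proof (rule bop_adjI)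
  fix x y
  have "(\<lambda>n. f n * coef x n * cnj (coef y n)) sums cinner (bop_apply (diag f) x) y"
    using cinner_sums[of "bop_apply (diag f) x" y] by (simp add: coef_diag[OF assms])
  moreover have "(\<lambda>n. f n * coef x n * cnj (coef y n)) sums cinner x (bop_apply (diag (\<lambda>n. cnj (f n))) y)"
    using cinner_sums[of x "bop_apply (diag (\<lambda>n. cnj (f n))) y"] assms
    by (simp add: coef_diag[of _ B] mult_ac)
  ultimately show "cinner (bop_apply (diag f) x) y = cinner x (bop_apply (diag (\<lambda>n. cnj (f n))) y)"
    by (rule sums_unique2)
qed

lemma norm_le_coef:
  assumes "B \<ge> 0" "\<And>n. cmod (coef y n) \<le> B * cmod (coef x n)"
  shows "norm y \<le> B * norm x"
proof (rule power2_le_imp_le)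
  have "(\<lambda>n. B\<^sup>2 * (cmod (coef x n))\<^sup>2) sums (B\<^sup>2 * (norm x)\<^sup>2)"
    by (intro sums_mult Parseval)
  moreover have "(cmod (coef y n))\<^sup>2 \<le> B\<^sup>2 * (cmod (coef x n))\<^sup>2" for n
    using power_mono[OF assms(2)[of n], of 2] by (simp add: power_mult_distrib)
  ultimately have "(norm y)\<^sup>2 \<le> B\<^sup>2 * (norm x)\<^sup>2"
    by (intro sums_le[OF _ Parseval])
  then show "(norm y)\<^sup>2 \<le> (B * norm x)\<^sup>2"
    by (simp only: power_mult_distrib)
qed (use assms in simp)

lemma norm_le_coef1: "(\<And>n. cmod (coef y n) \<le> cmod (coef x n)) \<Longrightarrow> norm y \<le> norm x"
  using norm_le_coef[of 1 y x] by simp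

lemma norm_proj: "norm (proj S) \<le> 1"
  by (intro norm_bop_le norm_le_coef) auto

lemma norm_diag_unit: "(\<And>n. cmod (f n) = 1) \<Longrightarrow> norm (diag f) \<le> 1"
  by (intro norm_bop_le norm_le_coef) (auto simp: norm_mult)

lemma proj_mult: "proj S * proj S' = proj (S \<inter> S')"
  by (rule bop_coef_eqI) auto

lemma proj_mult_le:
  assumes "A \<subseteq> A'" "B \<subseteq> B'"
  shows "norm (proj A * a * proj B) \<le> norm (proj A' * a * proj B')"
proof -
  have "proj A * a * proj B = proj A * (proj A' * a * proj B') * proj B"
    using assms by (metis mult.assoc proj_mult inf.absorb1 inf.absorb2)
  then show ?thesis by (simp add: norm_mult3_le norm_proj)
qed

lemma norm_proj_finite:
  assumes "finite S"
  shows "(norm (bop_apply (proj S) x))\<^sup>2 = (\<Sum>n\<in>S. (cmod (coef x n))\<^sup>2)"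
proof -
  have "(\<lambda>n. (cmod (coef (bop_apply (proj S) x) n))\<^sup>2) sums (\<Sum>n\<in>S. (cmod (coef (bop_apply (proj S) x) n))\<^sup>2)"
    by (rule sums_finite) (use assms in auto)
  then show ?thesis using sums_unique2[OF Parseval] by (fastforce intro: sum.cong)
qed

lemma norm_proj_le_finite:
  assumes "\<And>F. finite F \<Longrightarrow> F \<subseteq> S \<Longrightarrow> (\<Sum>n\<in>F. (cmod (coef x n))\<^sup>2) \<le> C"
  shows "(norm (bop_apply (proj S) x))\<^sup>2 \<le> C"
proof -
  let ?y = "bop_apply (proj S) x"
  have "(\<Sum>n<m. (cmod (coef ?y n))\<^sup>2) \<le> C" for m
  proof -
    have "(\<Sum>n<m. (cmod (coef ?y n))\<^sup>2) = (\<Sum>n\<in>{..<m} \<inter> S. (cmod (coef x n))\<^sup>2)"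
      by (rule sum.mono_neutral_cong_right) auto
    also have "\<dots> \<le> C" by (rule assms) auto
    finally show ?thesis .
  qed
  then show ?thesis
    unfolding sums_unique[OF Parseval[of ?y]] by (intro suminf_le_const summable_coef) auto
qed

lemma compact_op_proj_finite:
  assumes "finite S"
  shows "compact_op (proj S)"
  using assms
proof (induction S)
  case empty
  have "proj {} = 0" by (rule bop_coef_eqI) auto
  then show ?case by (simp add: compact_op_zero)
next
  case (insert n S)
  have "proj (insert n S) = proj {n} + proj S"
    by (rule bop_coef_eqI) (use insert.hyps in auto)
  moreover have "compact_op (proj {n})"
  proof -
    let ?K = "(\<lambda>c. c *\<^sub>C e n) ` cball 0 1"
    have cont: "continuous_on UNIV (\<lambda>c. c *\<^sub>C e n)"
    proof (intro bounded_linear.continuous_on[of "\<lambda>c. c *\<^sub>C e n"] continuous_on_id)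
      show "bounded_linear (\<lambda>c. c *\<^sub>C e n)"
      proof (rule bounded_linear_intro[of _ 1])
        show "(r *\<^sub>R c) *\<^sub>C e n = r *\<^sub>R c *\<^sub>C e n" for r and c :: complex
          by (simp add: scaleR_conv_of_real scaleC_scaleC flip: scaleC_of_real)
      qed (auto simp: scaleC_add_left norm_scaleC)
    qed
    have K: "compact ?K"
      by (intro compact_continuous_image continuous_on_subset[OF cont]) auto
    have "bop_apply (proj {n}) x \<in> ?K" if "norm x \<le> 1" for x
    proof (rule image_eqI)
      show "bop_apply (proj {n}) x = coef x n *\<^sub>C e n"
        by (rule coef_eqI) auto
      have "cmod (coef x n) \<le> norm x * norm (e n)"
        unfolding coef_def by (rule cmod_cinner_le)
      then show "coef x n \<in> cball 0 1" using that by simp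
    qed
    then have "closure (bop_apply (proj {n}) ` cball 0 1) \<subseteq> ?K"
      by (intro closure_minimal compact_imp_closed K) auto
    then show ?thesis
      unfolding compact_op_def using K by (metis closed_closure closed_Int_compact inf.absorb1)
  qed
  ultimately show ?case using insert.IH by (simp add: compact_op_add)
qed

text \<open>\<open>T\<close> is the norm limit of its truncations \<open>proj {..<N} * T\<close>,
  which are compact because the coordinate projection has finite rank.\<close>

lemma compact_op_tailI:
  assumes "\<And>\<epsilon>. \<epsilon> > 0 \<Longrightarrow> \<exists>N. \<forall>x. norm (bop_apply (proj {N..}) (bop_apply T x)) \<le> \<epsilon> * norm x"
  shows "compact_op T"
proof (rule compact_op_limit)
  fix \<epsilon> :: real assume "\<epsilon> > 0"
  then obtain N where N: "\<And>x. norm (bop_apply (proj {N..} * T) x) \<le> \<epsilon> / 2 * norm x"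
    using assms[of "\<epsilon> / 2"] by auto
  have "proj {..<N} * T + proj {N..} * T = T"
    by (rule bop_coef_eqI) auto
  then have "T - proj {..<N} * T = proj {N..} * T"
    by (metis add_diff_cancel_left')
  then have "norm (T - proj {..<N} * T) \<le> \<epsilon> / 2"
    using norm_bop_le[of "\<epsilon> / 2" "proj {N..} * T"] N \<open>\<epsilon> > 0\<close> by simp
  then show "\<exists>k. compact_op k \<and> norm (T - k) < \<epsilon>"
    using \<open>\<epsilon> > 0\<close> by (intro exI[of _ "proj {..<N} * T"])
      (simp add: compact_op_mult_right compact_op_proj_finite)
qed

text \<open>The two corners of the matrix of \<open>a\<close> outside the band: rows below
  \<open>n\<close> against columns from \<open>h n\<close> on, and the reverse. The summable bound
  \<open>(1/2) ^ n\<close> lets the errors of all blocks be added up; asking for it only eventually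
  makes the notion pass to dominating functions.\<close>

definition handles :: "(nat \<Rightarrow> nat) \<Rightarrow> 'h bop \<Rightarrow> bool" where
  "handles h a \<longleftrightarrow> (\<forall>\<^sub>F n in sequentially.
     norm (proj {..<n} * a * proj {h n..}) \<le> (1/2) ^ n \<and>
     norm (proj {h n..} * a * proj {..<n}) \<le> (1/2) ^ n)"

lemma handles_mono:
  assumes "handles h a" "dominated h h'"
  shows "handles h' a"
  using assms unfolding handles_def dominated_def
proof eventually_elim
  case (elim n)
  then show ?case
    using proj_mult_le[of "{..<n}" "{..<n}" "{h' n..}" "{h n..}" a]
      proj_mult_le[of "{h' n..}" "{h n..}" "{..<n}" "{..<n}" a] by auto
qed

section \<open>Commutators with diagonal unitaries\<close>

lemma diag_proj_commute: "(\<And>n. cmod (f n) = 1) \<Longrightarrow> diag f * proj S = proj S * diag f"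
  by (rule bop_coef_eqI) simp

text \<open>Diagonal unitaries commute with coordinate projections, so conjugation does not increase
  the norm of a corner.\<close>

lemma handles_conj:
  assumes "handles h a" "\<And>n. cmod (f n) = 1" "\<And>n. cmod (g n) = 1"
  shows "handles h (diag f * a * diag g)"
proof -
  have *: "norm (proj S * (diag f * a * diag g) * proj S') \<le> norm (proj S * a * proj S')" for S S'
  proof -
    have "proj S * (diag f * a * diag g) * proj S' = diag f * (proj S * a * proj S') * diag g"
    proof -
      have "proj S * (diag f * a * diag g) * proj S' = (proj S * diag f) * a * (diag g * proj S')"
        by (simp only: mult.assoc)
      also have "\<dots> = (diag f * proj S) * a * (proj S' * diag g)"
        using assms(2,3) by (simp only: diag_proj_commute)
      finally show ?thesis by (simp only: mult.assoc)
    qed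
    then show ?thesis by (simp add: norm_mult3_le norm_diag_unit assms)
  qed
  show ?thesis
    using assms(1) unfolding handles_def
    by eventually_elim (use * order_trans in blast)
qed

text \<open>No cancellation is exploited off the band: the projections commute with
  \<open>diag \<gamma>\<close>, so the corner of the commutator is the commutator with the corner of
  \<open>a\<close>.\<close>

lemma commutator_off_diagonal:
  assumes \<gamma>: "\<And>n. cmod (\<gamma> n) = 1"
  shows "norm (bop_apply (proj S * (diag \<gamma> * a - a * diag \<gamma>) * proj S') x)
    \<le> 2 * norm (proj S * a * proj S') * norm x"
proof -
  let ?A = "proj S * a * proj S'"
  have "proj S * (diag \<gamma> * a - a * diag \<gamma>) * proj S' = diag \<gamma> * ?A - ?A * diag \<gamma>"
  proof -
    have "proj S * (diag \<gamma> * a - a * diag \<gamma>) * proj S' =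
        (proj S * diag \<gamma>) * a * proj S' - proj S * a * (diag \<gamma> * proj S')"
      by (simp only: right_diff_distrib left_diff_distrib mult.assoc)
    also have "\<dots> = (diag \<gamma> * proj S) * a * proj S' - proj S * a * (proj S' * diag \<gamma>)"
      using \<gamma> by (simp only: diag_proj_commute)
    finally show ?thesis by (simp only: mult.assoc)
  qed
  moreover have "norm (diag \<gamma> * ?A - ?A * diag \<gamma>) \<le> 2 * norm ?A"
    using norm_triangle_ineq4[of "diag \<gamma> * ?A" "?A * diag \<gamma>"]
      norm_mult3_le[of "diag \<gamma>" 1 ?A] norm_mult3_le[of 1 "diag \<gamma>" ?A]
      norm_diag_unit[of \<gamma>, OF \<gamma>] norm_bop_le[of 1 "1 :: 'h bop"] by simp
  ultimately show ?thesis
    using order_trans[OF norm_bop_apply mult_right_mono[OF _ norm_ge_zero]] by (simp only:)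
qed

text \<open>Subtracting the scalar \<open>c\<close> from \<open>diag \<gamma>\<close> does not
  change the commutator, and the difference has size at most \<open>\<delta>\<close> on the
  coordinates in \<open>S'\<close>. Each of the two products contributes
  \<open>\<delta> * norm a\<close>; the inclusion \<open>S \<subseteq> S'\<close> covers the product
  with the diagonal factor on the left.\<close>

lemma commutator_diagonal:
  assumes \<gamma>: "\<And>n. cmod (\<gamma> n) = 1" and \<delta>: "\<delta> \<ge> 0" "\<And>j. j \<in> S' \<Longrightarrow> cmod (\<gamma> j - c) \<le> \<delta>" and "S \<subseteq> S'"
  shows "norm (bop_apply (proj S * (diag \<gamma> * a - a * diag \<gamma>) * proj S') x)
    \<le> 2 * \<delta> * norm a * norm (bop_apply (proj S') x)"
proof -
  define y where "y = bop_apply (proj S') x"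
  let ?D = "diag \<gamma> - c *\<^sub>C 1"
  have Dle: "norm (bop_apply (proj S') (bop_apply ?D z)) \<le> \<delta> * norm z" for z
    by (rule norm_le_coef) (use \<delta> in \<open>auto simp: \<gamma> norm_mult simp flip: left_diff_distrib intro!: mult_right_mono\<close>)
  have S: "norm (bop_apply (proj S) z) \<le> norm (bop_apply (proj S') z)" for z
    by (rule norm_le_coef1) (use \<open>S \<subseteq> S'\<close> in auto)
  have S1: "norm (bop_apply (proj S) z) \<le> norm z" for z
    by (rule norm_le_coef1) auto
  have "bop_apply (proj S) (bop_apply (diag \<gamma> * a - a * diag \<gamma>) y) =
      bop_apply (proj S) (bop_apply ?D (bop_apply a y)) - bop_apply (proj S) (bop_apply a (bop_apply ?D y))"
    by (simp add: bop_apply_diff bop_apply_scaleC)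
  also have "norm \<dots> \<le> norm (bop_apply (proj S) (bop_apply ?D (bop_apply a y)))
       + norm (bop_apply (proj S) (bop_apply a (bop_apply ?D y)))"
    by (rule norm_triangle_ineq4)
  also have "\<dots> \<le> \<delta> * (norm a * norm y) + norm a * (\<delta> * norm y)"
  proof (rule add_mono)
    have "norm (bop_apply (proj S) (bop_apply ?D (bop_apply a y))) \<le> \<delta> * norm (bop_apply a y)"
      using S Dle order_trans by blast
    also have "\<dots> \<le> \<delta> * (norm a * norm y)"
      by (intro mult_left_mono norm_bop_apply \<delta>)
    finally show "norm (bop_apply (proj S) (bop_apply ?D (bop_apply a y))) \<le> \<delta> * (norm a * norm y)" .
    have "bop_apply ?D y = bop_apply (proj S') (bop_apply ?D y)"
      by (rule coef_eqI) (auto simp: y_def \<gamma>)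
    then have "norm (bop_apply ?D y) \<le> \<delta> * norm y" using Dle by metis
    then have "norm a * norm (bop_apply ?D y) \<le> norm a * (\<delta> * norm y)"
      by (intro mult_left_mono) auto
    then show "norm (bop_apply (proj S) (bop_apply a (bop_apply ?D y))) \<le> norm a * (\<delta> * norm y)"
      using S1 norm_bop_apply order_trans by meson
  qed
  finally have "norm (bop_apply (proj S) (bop_apply (diag \<gamma> * a - a * diag \<gamma>) y)) \<le> 2 * \<delta> * norm a * norm y"
    by (simp add: mult_ac)
  then show ?thesis by (simp only: y_def bop_apply_simps(6))
qed

text \<open>The columns are split at \<open>p'\<close> and \<open>q'\<close>. The middle part is
  governed by the small variation of \<open>\<gamma>\<close>; each outer part lies in a corner of
  \<open>a\<close> of norm at most \<open>\<rho>\<close> and costs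
  \<open>2 * \<rho>\<close>.\<close>

lemma commutator_block:
  assumes \<gamma>: "\<And>n. cmod (\<gamma> n) = 1" and \<delta>: "\<delta> \<ge> 0" "\<And>j. j \<in> {p'..<q'} \<Longrightarrow> cmod (\<gamma> j - c) \<le> \<delta>"
    and pq: "p' \<le> p" "p \<le> q" "q \<le> q'"
    and \<rho>: "norm (proj {..<q} * a * proj {q'..}) \<le> \<rho>" "norm (proj {p..} * a * proj {..<p'}) \<le> \<rho>"
  shows "norm (bop_apply (proj {p..<q} * (diag \<gamma> * a - a * diag \<gamma>)) x)
    \<le> 2 * \<delta> * norm a * norm (bop_apply (proj {p'..<q'}) x) + 4 * \<rho> * norm x"
proof -
  let ?T = "proj {p..<q} * (diag \<gamma> * a - a * diag \<gamma>)"
  have "?T = ?T * proj {..<p'} + ?T * proj {p'..<q'} + ?T * proj {q'..}"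
  proof -
    have "1 = proj {..<p'} + proj {p'..<q'} + proj {q'..}"
      by (rule bop_coef_eqI) (use pq in auto)
    then show ?thesis by (metis distrib_left mult_1_right)
  qed
  then have "bop_apply ?T x = bop_apply (?T * proj {..<p'}) x
      + bop_apply (?T * proj {p'..<q'}) x + bop_apply (?T * proj {q'..}) x"
    by (metis (no_types) bop_apply_simps(3))
  then have "norm (bop_apply ?T x) \<le> norm (bop_apply (?T * proj {..<p'}) x)
      + norm (bop_apply (?T * proj {p'..<q'}) x) + norm (bop_apply (?T * proj {q'..}) x)"
    by (simp only:) (intro norm_triangle_mono order_refl)
  moreover have "norm (bop_apply (?T * proj {..<p'}) x) \<le> 2 * \<rho> * norm x"
  proof (rule order_trans[OF commutator_off_diagonal[OF \<gamma>]])
    show "2 * norm (proj {p..<q} * a * proj {..<p'}) * norm x \<le> 2 * \<rho> * norm x"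
      by (intro mult_right_mono mult_left_mono order_trans[OF proj_mult_le \<rho>(2)]) auto
  qed
  moreover have "norm (bop_apply (?T * proj {q'..}) x) \<le> 2 * \<rho> * norm x"
  proof (rule order_trans[OF commutator_off_diagonal[OF \<gamma>]])
    show "2 * norm (proj {p..<q} * a * proj {q'..}) * norm x \<le> 2 * \<rho> * norm x"
      by (intro mult_right_mono mult_left_mono order_trans[OF proj_mult_le \<rho>(1)]) auto
  qed
  moreover have "norm (bop_apply (?T * proj {p'..<q'}) x)
      \<le> 2 * \<delta> * norm a * norm (bop_apply (proj {p'..<q'}) x)"
    by (rule commutator_diagonal[OF \<gamma> \<delta>]) (use pq in auto)
  ultimately show ?thesis by linarith
qed


text \<open>The iterates of \<open>h\<close> at 0 cut the indices into blocks. Up to summable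
  errors, row block \<open>Suc k\<close> of \<open>a\<close> meets only the column blocks
  \<open>k\<close>, \<open>Suc k\<close> and \<open>Suc (Suc k)\<close>, on which
  \<open>\<gamma>\<close> is almost constant. Each column block is counted at most three times, so
  the squared block estimates add up by Bessel, and the rows far out have small norm.\<close>

lemma compact_commutator:
  assumes h: "growing h" and a: "handles h a"
    and \<gamma>: "\<And>n. cmod (\<gamma> n) = 1" and sl: "slow h \<gamma>"
  shows "compact_op (diag \<gamma> * a - a * diag \<gamma>)"
proof (rule compact_op_tailI)
  fix \<epsilon> :: real assume \<epsilon>: "\<epsilon> > 0"
  let ?T = "diag \<gamma> * a - a * diag \<gamma>"
  define n where "n k = (h ^^ k) 0" for k
  have n_Suc: "n (Suc k) = h (n k)" for k by (simp add: n_def)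
  have n_sm: "strict_mono n" by (rule strict_monoI_Suc) (use h in \<open>simp add: n_Suc growing_def\<close>)
  have n_mono: "mono n" using n_sm by (rule strict_mono_mono)
  have n_ge: "k \<le> n k" for k using n_sm by (rule strict_mono_imp_increasing)
  \<comment> \<open>In the final sum the three neighbouring blocks contribute
    \<open>(norm x)\<^sup>2\<close> each and the geometric errors at most twice that, hence the
    5.\<close>
  define \<eta> where "\<eta> = \<epsilon>\<^sup>2 / 5"
  have \<eta>: "\<eta> > 0" using \<epsilon> by (simp add: \<eta>_def)
  \<comment> \<open>The 8 is \<open>2 * 2\<^sup>2\<close>: the factor 2 of the block estimate is
    squared, and splitting the square of a sum doubles it. The summand 1 keeps the divisor
    positive.\<close>
  define \<delta> where "\<delta> = sqrt (\<eta> / 8) / (norm a + 1)"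
  have pos: "norm a + 1 > 0" by (simp add: add_nonneg_pos)
  have \<delta>: "\<delta> > 0" using \<eta> pos by (simp add: \<delta>_def)
  have "\<delta> * norm a \<le> sqrt (\<eta> / 8)"
    using \<eta> pos by (simp add: \<delta>_def field_simps)
  then have "(\<delta> * norm a)\<^sup>2 \<le> (sqrt (\<eta> / 8))\<^sup>2"
    using \<delta> by (intro power_mono) auto
  then have \<delta>a: "8 * (\<delta> * norm a)\<^sup>2 \<le> \<eta>" using \<eta> by simp
  obtain K1 where K1: "\<And>m. m \<ge> K1 \<Longrightarrow> norm (proj {..<m} * a * proj {h m..}) \<le> (1/2) ^ m"
      "\<And>m. m \<ge> K1 \<Longrightarrow> norm (proj {h m..} * a * proj {..<m}) \<le> (1/2) ^ m"
    using a unfolding handles_def eventually_sequentially by blast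
  obtain K2 where K2: "\<And>i j. i \<ge> K2 \<Longrightarrow> j \<in> {i..h i} \<Longrightarrow> cmod (\<gamma> i - \<gamma> j) < \<delta> / 2"
    using sl half_gt_zero[OF \<delta>] unfolding slow_def eventually_sequentially by blast
  \<comment> \<open>The 32 is \<open>2 * 4\<^sup>2\<close>. Of the two factors
    \<open>(1/2) ^ k\<close> in the squared error, one is used to get below \<open>\<eta>\<close>,
    the other is kept for the summation over \<open>k\<close>.\<close>
  obtain K3 where K3: "(1/2) ^ K3 < \<eta> / 32"
    using real_arch_pow_inv[of "\<eta> / 32" "1/2"] \<eta> by auto
  define K where "K = Max {K1, K2, K3}"
  have K: "K1 \<le> K" "K2 \<le> K" "K3 \<le> K" by (simp_all add: K_def)
  define P where "P k x = (norm (bop_apply (proj {n k..<n (Suc k)}) x))\<^sup>2" for k x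
  have P_sum: "(\<Sum>k<L. P (m + k) x) = (\<Sum>j\<in>{n m..<n (m + L)}. (cmod (coef x j))\<^sup>2)" for m L x
    using sum_intervals[of "\<lambda>k. n (m + k)" "\<lambda>j. (cmod (coef x j))\<^sup>2" L] n_mono
    by (simp add: P_def norm_proj_finite mono_def)
  have P_sum_le: "(\<Sum>k<L. P (m + k) x) \<le> (norm x)\<^sup>2" for m L x
    unfolding P_sum by (rule Bessel) simp
  have block: "P (Suc k) (bop_apply ?T x) \<le>
      \<eta> * (P k x + P (Suc k) x + P (Suc (Suc k)) x + (1/2) ^ k * (norm x)\<^sup>2)" if k: "k \<ge> K" for k x
  proof -
    let ?Q = "norm (bop_apply (proj {n k..<n (k + 3)}) x)"
    have le: "n k \<le> n (Suc k)" "n (Suc k) \<le> n (Suc (Suc k))" "n (Suc (Suc k)) \<le> n (k + 3)"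
      using n_mono by (auto simp: mono_def)
    have kK: "K2 \<le> n k" "K2 \<le> n (Suc k)" "K2 \<le> n (Suc (Suc k))" "K1 \<le> n k" "K1 \<le> n (Suc (Suc k))"
      using K k n_ge[of k] le by linarith+
    \<comment> \<open>All three blocks are compared with the start of the middle one; at most two
      steps of slowness are needed, each below \<open>\<delta> / 2\<close>.\<close>
    have close: "cmod (\<gamma> j - \<gamma> (n (Suc k))) \<le> \<delta>" if j: "j \<in> {n k..<n (k + 3)}" for j
    proof -
      consider "j \<in> {n k..n (Suc k)}" | "j \<in> {n (Suc k)..n (Suc (Suc k))}"
        | "j \<in> {n (Suc (Suc k))..n (Suc (Suc (Suc k)))}"
        using j le by (auto simp: numeral_3_eq_3) linarith
      then show ?thesis
      proof cases
        case 1
        then have "cmod (\<gamma> (n k) - \<gamma> j) < \<delta> / 2" "cmod (\<gamma> (n k) - \<gamma> (n (Suc k))) < \<delta> / 2"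
          using K2[OF kK(1)] le by (auto simp: n_Suc)
        then show ?thesis
          using norm_triangle_ineq4[of "\<gamma> (n k) - \<gamma> (n (Suc k))" "\<gamma> (n k) - \<gamma> j"] by simp
      next
        case 2
        then have "cmod (\<gamma> (n (Suc k)) - \<gamma> j) < \<delta> / 2"
          using K2[OF kK(2)] by (auto simp: n_Suc)
        then show ?thesis using \<delta> by (simp add: norm_minus_commute)
      next
        case 3
        then have "cmod (\<gamma> (n (Suc (Suc k))) - \<gamma> j) < \<delta> / 2"
            "cmod (\<gamma> (n (Suc k)) - \<gamma> (n (Suc (Suc k)))) < \<delta> / 2"
          using K2[OF kK(3)] K2[OF kK(2), of "n (Suc (Suc k))"] le by (auto simp: n_Suc)
        then show ?thesis
          using norm_triangle_ineq[of "\<gamma> (n (Suc k)) - \<gamma> (n (Suc (Suc k)))" "\<gamma> (n (Suc (Suc k))) - \<gamma> j"]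
          by (simp add: norm_minus_commute)
      qed
    qed
    have pow: "(1/2 :: real) ^ m \<le> (1/2) ^ k" if "k \<le> m" for m
      using that by (intro power_decreasing) auto
    have \<rho>: "norm (proj {..<n (Suc (Suc k))} * a * proj {n (k + 3)..}) \<le> (1/2) ^ k"
        "norm (proj {n (Suc k)..} * a * proj {..<n k}) \<le> (1/2) ^ k"
    proof -
      have "k \<le> n k" "k \<le> n (Suc (Suc k))" using n_ge[of k] le by linarith+
      note * = this[THEN pow]
      show "norm (proj {..<n (Suc (Suc k))} * a * proj {n (k + 3)..}) \<le> (1/2) ^ k"
        using order_trans[OF K1(1)[OF kK(5)] *(2)] by (simp add: n_Suc numeral_3_eq_3)
      show "norm (proj {n (Suc k)..} * a * proj {..<n k}) \<le> (1/2) ^ k"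
        using order_trans[OF K1(2)[OF kK(4)] *(1)] by (simp add: n_Suc)
    qed
    have "norm (bop_apply (proj {n (Suc k)..<n (Suc (Suc k))} * ?T) x)
        \<le> 2 * \<delta> * norm a * ?Q + 4 * (1/2) ^ k * norm x"
      by (rule commutator_block[OF \<gamma> less_imp_le[OF \<delta>] close le \<rho>])
    then have "P (Suc k) (bop_apply ?T x) \<le> (2 * \<delta> * norm a * ?Q + 4 * (1/2) ^ k * norm x)\<^sup>2"
      unfolding P_def by (intro power_mono) auto
    also have "\<dots> \<le> 2 * (2 * \<delta> * norm a * ?Q)\<^sup>2 + 2 * (4 * (1/2) ^ k * norm x)\<^sup>2"
      using zero_le_power2[of "2 * \<delta> * norm a * ?Q - 4 * (1/2) ^ k * norm x"]
      by (simp add: power2_sum power2_diff)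
    also have "2 * (2 * \<delta> * norm a * ?Q)\<^sup>2 = 8 * (\<delta> * norm a)\<^sup>2 * ?Q\<^sup>2"
      by (simp add: power_mult_distrib)
    also have "\<dots> \<le> \<eta> * ?Q\<^sup>2" by (intro mult_right_mono \<delta>a) simp
    also have "2 * (4 * (1/2) ^ k * norm x)\<^sup>2 = (32 * (1/2) ^ k) * ((1/2) ^ k * (norm x)\<^sup>2)"
      by (simp add: power_mult_distrib power2_eq_square)
    also have "\<dots> \<le> \<eta> * ((1/2) ^ k * (norm x)\<^sup>2)"
    proof (rule mult_right_mono)
      have "(1/2 :: real) ^ k \<le> (1/2) ^ K3" using K k by (intro power_decreasing) auto
      then show "32 * (1/2) ^ k \<le> \<eta>" using K3 by linarith
    qed simp
    also have "?Q\<^sup>2 = P k x + P (Suc k) x + P (Suc (Suc k)) x"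
      using P_sum[of k x 3] by (simp add: norm_proj_finite numeral_3_eq_3)
    finally show ?thesis by (simp add: distrib_left)
  qed
  have "norm (bop_apply (proj {n (Suc K)..}) (bop_apply ?T x)) \<le> \<epsilon> * norm x" for x
  proof (rule power2_le_imp_le)
    show "(norm (bop_apply (proj {n (Suc K)..}) (bop_apply ?T x)))\<^sup>2 \<le> (\<epsilon> * norm x)\<^sup>2"
    proof (rule norm_proj_le_finite)
      fix F assume F: "finite F" "F \<subseteq> {n (Suc K)..}"
      obtain L where L: "\<And>j. j \<in> F \<Longrightarrow> j < L"
        using F(1) finite_nat_iff_bounded by auto
      have "F \<subseteq> {n (Suc K)..<n (Suc K + L)}"
        using F(2) L n_ge[of "Suc K + L"] by fastforce
      then have "(\<Sum>j\<in>F. (cmod (coef (bop_apply ?T x) j))\<^sup>2)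
          \<le> (\<Sum>j\<in>{n (Suc K)..<n (Suc K + L)}. (cmod (coef (bop_apply ?T x) j))\<^sup>2)"
        by (intro sum_mono2) auto
      also have "\<dots> = (\<Sum>k<L. P (Suc K + k) (bop_apply ?T x))" by (rule P_sum[symmetric])
      also have "\<dots> \<le> (\<Sum>k<L. \<eta> * (P (K + k) x + P (Suc K + k) x + P (Suc (Suc K) + k) x
          + (1/2) ^ (K + k) * (norm x)\<^sup>2))"
        by (intro sum_mono) (use block[of "K + _" x] in simp)
      also have "\<dots> = \<eta> * ((\<Sum>k<L. P (K + k) x) + (\<Sum>k<L. P (Suc K + k) x)
          + (\<Sum>k<L. P (Suc (Suc K) + k) x) + (\<Sum>k<L. (1/2) ^ (K + k)) * (norm x)\<^sup>2)"
        by (simp only: sum.distrib sum_distrib_left sum_distrib_right distrib_left)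
      also have "\<dots> \<le> \<eta> * ((norm x)\<^sup>2 + (norm x)\<^sup>2 + (norm x)\<^sup>2 + 2 * (norm x)\<^sup>2)"
      proof (intro mult_left_mono add_mono mult_right_mono P_sum_le)
        have "(\<Sum>k<L. (1/2 :: real) ^ (K + k)) \<le> (\<Sum>k<L. (1/2) ^ k)"
          by (intro sum_mono power_decreasing) auto
        also have "\<dots> \<le> 2" by (simp add: sum_gp_strict)
        finally show "(\<Sum>k<L. (1/2 :: real) ^ (K + k)) \<le> 2" .
      qed (use \<eta> in auto)
      also have "\<dots> = (\<epsilon> * norm x)\<^sup>2" by (simp add: \<eta>_def power_mult_distrib)
      finally show "(\<Sum>j\<in>F. (cmod (coef (bop_apply ?T x) j))\<^sup>2) \<le> (\<epsilon> * norm x)\<^sup>2" .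
    qed
  qed (use \<epsilon> in simp)
  then show "\<exists>N. \<forall>x. norm (bop_apply (proj {N..}) (bop_apply ?T x)) \<le> \<epsilon> * norm x" by blast
qed

text \<open>The finitely many columns \<open>bop_apply a (e i)\<close> with \<open>i < n\<close>
  have small tails beyond a common index. The opposite corner is handled by passing to the adjoint,
  which has the same norm. The \<open>h\<close> found here need not be \<open>growing\<close>; a
  dominating function repairs this later.\<close>

lemma handles_exists: "\<exists>h. handles h a"
proof -
  have tail: "\<exists>m. norm (bop_apply (proj {m..}) y) < \<epsilon>" if "\<epsilon> > 0" for y \<epsilon>
  proof -
    have "\<epsilon>\<^sup>2 / 2 > 0" using that by simp
    then obtain N where N: "\<And>n. norm (\<Sum>j=N..<n. (cmod (coef y j))\<^sup>2) < \<epsilon>\<^sup>2 / 2"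
      using summable_coef[of y, unfolded summable_Cauchy] by blast
    have "(norm (bop_apply (proj {N..}) y))\<^sup>2 \<le> \<epsilon>\<^sup>2 / 2"
    proof (rule norm_proj_le_finite)
      fix F assume F: "finite F" "F \<subseteq> {N..}"
      obtain L where L: "\<And>j. j \<in> F \<Longrightarrow> j < L"
        using F(1) finite_nat_iff_bounded by auto
      have "(\<Sum>j\<in>F. (cmod (coef y j))\<^sup>2) \<le> (\<Sum>j=N..<L. (cmod (coef y j))\<^sup>2)"
        by (intro sum_mono2) (use F L in auto)
      then show "(\<Sum>j\<in>F. (cmod (coef y j))\<^sup>2) \<le> \<epsilon>\<^sup>2 / 2" using N[of L] by simp
    qed
    also have "\<dots> < \<epsilon>\<^sup>2" using that by simp
    finally show ?thesis using that by (meson less_imp_le power2_less_imp_less)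
  qed
  have right: "\<exists>m. \<forall>m'\<ge>m. norm (proj {m'..} * b * proj {..<n}) \<le> \<epsilon>" if "\<epsilon> > 0" for b n \<epsilon>
  proof -
    define \<epsilon>' where "\<epsilon>' = \<epsilon> / (real n + 1)"
    have \<epsilon>': "\<epsilon>' > 0" using that by (simp add: \<epsilon>'_def)
    have "\<forall>i. \<exists>m. norm (bop_apply (proj {m..}) (bop_apply b (e i))) < \<epsilon>'"
      using tail[OF \<epsilon>'] by blast
    then obtain f where f: "\<And>i. norm (bop_apply (proj {f i..}) (bop_apply b (e i))) < \<epsilon>'"
      using choice[of "\<lambda>i m. norm (bop_apply (proj {m..}) (bop_apply b (e i))) < \<epsilon>'"] by blast
    have "norm (proj {m'..} * b * proj {..<n}) \<le> \<epsilon>" if m': "m' \<ge> (\<Sum>i<n. f i)" for m'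
    proof (rule norm_bop_le)
      fix x
      have "bop_apply (proj {..<n}) x = (\<Sum>i<n. coef x i *\<^sub>C e i)"
      proof (rule coef_eqI)
        fix j
        have "(\<Sum>i<n. coef x i * (if i = j then 1 else 0)) = (if j < n then coef x j else 0)"
          by (simp add: if_distrib[of "\<lambda>c. _ * c"] cong: if_cong)
        then show "coef (bop_apply (proj {..<n}) x) j = coef (\<Sum>i<n. coef x i *\<^sub>C e i) j"
          by (simp add: coef_sum)
      qed
      then have "bop_apply (proj {m'..} * b * proj {..<n}) x
          = (\<Sum>i<n. coef x i *\<^sub>C bop_apply (proj {m'..}) (bop_apply b (e i)))"
        by (simp add: bop_apply_scaleC linear_sum[OF bounded_linear.linear[OF bop_apply_bounded_linear]])
      also have "norm \<dots> \<le> (\<Sum>i<n. norm x * \<epsilon>')"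
      proof (rule sum_norm_le)
        fix i assume i: "i \<in> {..<n}"
        have "f i \<le> m'" using m' member_le_sum[OF i, of f] by simp
        then have "norm (bop_apply (proj {m'..}) (bop_apply b (e i))) \<le> norm (bop_apply (proj {f i..}) (bop_apply b (e i)))"
          by (intro norm_le_coef1) auto
        also have "\<dots> \<le> \<epsilon>'" by (rule less_imp_le[OF f])
        finally show "norm (coef x i *\<^sub>C bop_apply (proj {m'..}) (bop_apply b (e i))) \<le> norm x * \<epsilon>'"
          using cmod_cinner_le[of x "e i"]
          by (auto simp: norm_scaleC coef_def intro!: mult_mono)
      qed
      also have "\<dots> \<le> \<epsilon> * norm x"
        using \<open>\<epsilon> > 0\<close> by (simp add: \<epsilon>'_def field_simps)
      finally show "norm (bop_apply (proj {m'..} * b * proj {..<n}) x) \<le> \<epsilon> * norm x" .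
    qed (use \<open>\<epsilon> > 0\<close> in simp)
    then show ?thesis by blast
  qed
  have adj: "bop_adj (proj S) = proj S" for S
    unfolding proj_def by (subst bop_adj_diag[of _ 1]) (auto simp: indicator_def intro!: arg_cong[of _ _ diag])
  have left: "norm (proj S * a * proj S') = norm (proj S' * bop_adj a * proj S)" for S S'
    using norm_bop_adj[of "proj S * a * proj S'"] by (simp add: bop_adj_mult adj mult.assoc)
  have "\<exists>m. norm (proj {..<n} * a * proj {m..}) \<le> (1/2) ^ n \<and> norm (proj {m..} * a * proj {..<n}) \<le> (1/2) ^ n" for n
  proof -
    obtain m1 where "\<And>m'. m' \<ge> m1 \<Longrightarrow> norm (proj {m'..} * a * proj {..<n}) \<le> (1/2) ^ n"
      using right[of "(1/2) ^ n" a n] by auto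
    moreover obtain m2 where "\<And>m'. m' \<ge> m2 \<Longrightarrow> norm (proj {m'..} * bop_adj a * proj {..<n}) \<le> (1/2) ^ n"
      using right[of "(1/2) ^ n" "bop_adj a" n] by auto
    ultimately show ?thesis
      by (intro exI[of _ "max m1 m2"]) (auto simp: left[of "{..<n}"])
  qed
  then obtain h where "\<And>n. norm (proj {..<n} * a * proj {h n..}) \<le> (1/2) ^ n
      \<and> norm (proj {h n..} * a * proj {..<n}) \<le> (1/2) ^ n"
    using choice[of "\<lambda>n m. norm (proj {..<n} * a * proj {m..}) \<le> (1/2) ^ n
      \<and> norm (proj {m..} * a * proj {..<n}) \<le> (1/2) ^ n"] by blast
  then show ?thesis
    unfolding handles_def by (intro exI[of _ h] always_eventually allI)
qed

end

section \<open>Stages of the construction\<close>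

text \<open>A running maximum along an enumeration of \<open>S\<close>. It may become stationary, so
  sets with and without a largest element are treated alike.\<close>

lemma cofinal_sequence:
  fixes R :: "'a rel"
  assumes S: "countable S" "S \<noteq> {}" and R: "trans R" "total R"
  obtains c :: "nat \<Rightarrow> 'a" where "\<And>k. c k \<in> S" "\<And>k l. k \<le> l \<Longrightarrow> (c k, c l) \<in> R\<^sup>="
    "\<And>y. y \<in> S \<Longrightarrow> \<exists>k. (y, c k) \<in> R\<^sup>="
proof -
  let ?f = "from_nat_into S"
  have f: "?f k \<in> S" for k using S(2) by (rule from_nat_into)
  define c where "c = rec_nat (?f 0) (\<lambda>k z. if (z, ?f (Suc k)) \<in> R then ?f (Suc k) else z)"
  have c_0: "c 0 = ?f 0" by (simp add: c_def)
  have c_Suc: "c (Suc k) = (if (c k, ?f (Suc k)) \<in> R then ?f (Suc k) else c k)" for k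
    by (simp add: c_def)
  have tr: "trans (R\<^sup>=)" using R(1) by (auto simp: trans_def)
  show thesis
  proof
    show "c k \<in> S" for k by (induction k) (auto simp: c_0 c_Suc f)
    have "(c k, c (k + d)) \<in> R\<^sup>=" for k d
    proof (induction d)
      case (Suc d)
      have "(c (k + d), c (k + Suc d)) \<in> R\<^sup>=" by (simp add: c_Suc)
      with Suc show ?case by (rule transD[OF tr])
    qed simp
    then show "(c k, c l) \<in> R\<^sup>=" if "k \<le> l" for k l
      using that by (metis le_iff_add)
    have le: "(?f k, c k) \<in> R\<^sup>=" for k
      using R(2) by (cases k) (auto simp: c_0 c_Suc total_on_def)
    show "\<exists>k. (y, c k) \<in> R\<^sup>=" if "y \<in> S" for y
      using le[of "to_nat_on S y"] S that by auto
  qed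
qed

text \<open>In a well-order of least length every proper initial segment is strictly smaller than
  the whole type. It embeds into the reals, so by CH it is countable or as large as the reals, and
  the latter would make it as large as the type.\<close>

lemma CH_wellorder:
  includes cardinal_syntax
  assumes CH: continuum_hypothesis and le: "(UNIV :: 'a set) \<lesssim> (UNIV :: real set)"
  obtains R :: "'a rel" where "wf R" "trans R" "total R" "\<And>x. countable {y. (y, x) \<in> R}"
proof -
  let ?r = "|UNIV :: 'a set|"
  have wo: "Well_order ?r" by (rule card_of_Well_order)
  have field: "Field ?r = UNIV" by (rule Field_card_of)
  have lin: "Linear_order ?r" using wo by (simp add: well_order_on_def)
  have count: "countable {y. (y, x) \<in> ?r - Id}" for x
  proof -
    let ?S = "{y. (y, x) \<in> ?r - Id}"
    have "?S = underS ?r x" by (auto simp: underS_def)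
    then have small: "|?S| <o ?r"
      using card_of_underS[OF card_of_Card_order] field by (metis UNIV_I)
    obtain g :: "'a \<Rightarrow> real" where g: "inj g" using le by (auto simp: lepoll_def)
    have "\<not> g ` ?S \<approx> (UNIV :: real set)"
    proof
      assume "g ` ?S \<approx> (UNIV :: real set)"
      then have "(UNIV :: real set) \<lesssim> ?S"
        by (meson eqpoll_sym eqpoll_imp_lepoll image_lepoll lepoll_trans)
      with le have "(UNIV :: 'a set) \<lesssim> ?S" by (rule lepoll_trans)
      then have "?r \<le>o |?S|" by (simp add: lepoll_def card_of_ordLeq)
      with small show False by (simp add: not_ordLess_ordLeq)
    qed
    then have "countable (g ` ?S)" using CH by (auto simp: continuum_hypothesis_def)
    then show ?thesis using g by (metis countable_image_inj_on inj_on_subset subset_UNIV)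
  qed
  show thesis
  proof (rule that[of "?r - Id"])
    show "wf (?r - Id)" using wo by (simp add: well_order_on_def)
    show "trans (?r - Id)"
      using lin by (intro trans_diff_Id) (auto simp: order_on_defs)
    show "total (?r - Id)"
      using lin field by (simp add: order_on_defs)
  qed (rule count)
qed

text \<open>Every real is coded by a set of naturals, so a complex sequence becomes a subset of the
  countable type \<open>nat \<times> bool \<times> nat\<close>, the boolean selecting real or
  imaginary part.\<close>

lemma nat_complex_lepoll_reals: "(UNIV :: (nat \<Rightarrow> complex) set) \<lesssim> (UNIV :: real set)"
proof -
  obtain g :: "real \<Rightarrow> nat set" where g: "inj g"
    using eqpoll_imp_lepoll[OF eqpoll_sym[OF nat_sets_eqpoll_reals]] by (auto simp: lepoll_def)
  define code where "code f = {(n, b, m). m \<in> g (if b then Re (f n) else Im (f n))}"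
    for f :: "nat \<Rightarrow> complex"
  have "inj code"
  proof (rule injI, rule ext)
    fix f f' :: "nat \<Rightarrow> complex" and n
    assume eq: "code f = code f'"
    have "g (if b then Re (f n) else Im (f n)) = g (if b then Re (f' n) else Im (f' n))" for b
    proof -
      have "m \<in> g (if b then Re (f n) else Im (f n)) \<longleftrightarrow> (n, b, m) \<in> code f" for f m
        by (simp add: code_def)
      with eq show ?thesis by blast
    qed
    from this[of True] this[of False] show "f n = f' n"
      by (simp add: inj_eq[OF g] complex_eq_iff)
  qed
  then have "inj (\<lambda>f. to_nat ` code f)"
    by (simp add: inj_on_def inj_image_eq_iff)
  then have "(UNIV :: (nat \<Rightarrow> complex) set) \<lesssim> (UNIV :: nat set set)"
    by (auto simp: lepoll_def)
  then show ?thesis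
    using nat_sets_eqpoll_reals eqpoll_imp_lepoll lepoll_trans by blast
qed

context onb
begin

lemma bop_lepoll_reals: "(UNIV :: 'h bop set) \<lesssim> (UNIV :: real set)"
proof (rule lepoll_trans[OF _ nat_complex_lepoll_reals])
  define entry where "entry a k = coef (bop_apply a (e (fst (prod_decode k)))) (snd (prod_decode k))"
    for a :: "'h bop" and k
  have "inj entry"
  proof (rule injI)
    fix a b assume eq: "entry a = entry b"
    have ab: "bop_apply a (e i) = bop_apply b (e i)" for i
      by (rule coef_eqI) (use fun_cong[OF eq, of "prod_encode (i, _)"] in \<open>simp add: entry_def\<close>)
    show "a = b"
    proof (rule bop_eqI)
      fix x
      have "(\<lambda>n. bop_apply c (coef x n *\<^sub>C e n)) sums bop_apply c x" for c
        by (rule bounded_linear.sums[OF bop_apply_bounded_linear expansion])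
      from this[of a] this[of b] show "bop_apply a x = bop_apply b x"
        by (simp add: bop_apply_scaleC ab sums_unique2)
    qed
  qed
  then show "(UNIV :: 'h bop set) \<lesssim> (UNIV :: (nat \<Rightarrow> complex) set)"
    by (auto simp: lepoll_def)
qed

text \<open>This makes countable sets of stages bounded: countably many countable initial segments
  cannot exhaust the index type.\<close>

lemma uncountable_bop: "uncountable (UNIV :: 'h bop set)"
proof
  assume "countable (UNIV :: 'h bop set)"
  moreover have "inj (\<lambda>r :: real. r *\<^sub>R (1 :: 'h bop))"
  proof (rule injI)
    fix r s :: real assume "r *\<^sub>R (1 :: 'h bop) = s *\<^sub>R 1"
    then have "bop_apply (r *\<^sub>R 1) (e 0) = bop_apply (s *\<^sub>R 1) (e 0)" by (rule arg_cong)
    then have "r *\<^sub>R e 0 = s *\<^sub>R e 0" by simp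
    moreover have "e 0 \<noteq> 0" using norm_e[of 0] by (metis norm_zero zero_neq_one)
    ultimately show "r = s" by simp
  qed
  ultimately have "countable (UNIV :: real set)"
    using countable_image_inj_on countable_subset[OF subset_UNIV] by blast
  then show False using uncountable_UNIV_real by simp
qed

section \<open>Conjugation by diagonal unitaries\<close>

definition twist :: "(nat \<Rightarrow> complex) \<Rightarrow> 'h bop \<Rightarrow> 'h bop" where
  "twist \<alpha> a = diag \<alpha> * a * diag (\<lambda>n. cnj (\<alpha> n))"

lemma diag_e: "(\<And>n. cmod (f n) = 1) \<Longrightarrow> bop_apply (diag f) (e n) = f n *\<^sub>C e n"
  by (rule coef_eqI) auto

lemma diag_mult_unit:
  assumes "\<And>n. cmod (f n) = 1" "\<And>n. cmod (g n) = 1"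
  shows "diag f * diag g = diag (\<lambda>n. f n * g n)"
proof (rule bop_coef_eqI)
  fix x n
  have "coef (bop_apply (diag (\<lambda>n. f n * g n)) x) n = (f n * g n) * coef x n"
    by (rule coef_diag_unit) (simp add: assms norm_mult)
  then show "coef (bop_apply (diag f * diag g) x) n = coef (bop_apply (diag (\<lambda>n. f n * g n)) x) n"
    by (simp add: assms)
qed

lemma diag_one: "diag (\<lambda>n. 1) = 1"
  by (rule bop_coef_eqI) simp

lemma diag_cnj:
  assumes "\<And>n. cmod (\<alpha> n) = 1"
  shows "diag \<alpha> * diag (\<lambda>n. cnj (\<alpha> n)) = 1" "diag (\<lambda>n. cnj (\<alpha> n)) * diag \<alpha> = 1"
  using assms by (simp_all add: diag_mult_unit unit_mult_cnj mult.commute diag_one)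

lemma handles_twist: "handles h a \<Longrightarrow> (\<And>n. cmod (\<alpha> n) = 1) \<Longrightarrow> handles h (twist \<alpha> a)"
  unfolding twist_def by (rule handles_conj) auto

text \<open>With \<open>\<gamma>\<close> the quotient of the two sequences, twisting by
  \<open>\<beta>\<close> is twisting by \<open>\<alpha>\<close> followed by conjugation with
  \<open>diag \<gamma>\<close>. The difference is a commutator of \<open>diag \<gamma>\<close> with
  \<open>twist \<alpha> a\<close>, which lies in the same band as \<open>a\<close>, times a
  unitary.\<close>

lemma twist_coherent:
  assumes h: "growing h" "handles h a" and unit: "\<And>n. cmod (\<alpha> n) = 1" "\<And>n. cmod (\<beta> n) = 1"
    and coh: "coherent h \<alpha> \<beta>"
  shows "compact_op (twist \<beta> a - twist \<alpha> a)"
proof -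
  define \<gamma> where "\<gamma> n = \<beta> n * cnj (\<alpha> n)" for n
  have \<gamma>: "cmod (\<gamma> n) = 1" for n by (simp add: \<gamma>_def norm_mult unit)
  let ?G = "diag \<gamma>" and ?G' = "diag (\<lambda>n. cnj (\<gamma> n))" and ?b = "twist \<alpha> a"
  have "\<gamma> n * \<alpha> n = \<beta> n" for n
    using unit_mult_cnj[OF unit(1), of n] by (simp add: \<gamma>_def mult_ac)
  then have "?G * diag \<alpha> = diag \<beta>" "diag (\<lambda>n. cnj (\<alpha> n)) * ?G' = diag (\<lambda>n. cnj (\<beta> n))"
    using unit \<gamma> by (simp_all add: diag_mult_unit mult.commute flip: complex_cnj_mult)
  moreover have "?G * ?b * ?G' = (?G * diag \<alpha>) * a * (diag (\<lambda>n. cnj (\<alpha> n)) * ?G')"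
    by (simp only: twist_def mult.assoc)
  ultimately have "twist \<beta> a = ?G * ?b * ?G'"
    by (simp only: twist_def)
  then have "twist \<beta> a - ?b = (?G * ?b - ?b * ?G) * ?G'"
    using diag_cnj(1)[OF \<gamma>] by (simp add: left_diff_distrib mult.assoc)
  moreover have "compact_op (?G * ?b - ?b * ?G)"
  proof (rule compact_commutator[OF h(1) handles_twist[OF h(2)]])
    show "slow h \<gamma>" using coh unfolding coherent_def \<gamma>_def .
  qed (fact unit(1) \<gamma>)+
  ultimately show ?thesis by (simp add: compact_op_mult_right)
qed

text \<open>Unit vectors go to multiples of distinct basis vectors by factors of modulus at least 1.
  By the pigeonhole principle two images lie within 1/2 of the same point of a finite net, hence at
  distance below 1, while a single coordinate of their difference already has modulus at least
  1.\<close>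

lemma not_compact_op_shift:
  fixes p q :: "nat \<Rightarrow> nat"
  assumes "inj q" and c: "\<And>k. cmod (c k) \<ge> 1" and a: "\<And>k. bop_apply a (e (p k)) = c k *\<^sub>C e (q k)"
  shows "\<not> compact_op a"
proof
  assume a_compact: "compact_op a"
  have half: "(0 :: real) < 1/2" by simp
  obtain F where F: "finite F" "\<And>x. norm x \<le> 1 \<Longrightarrow> \<exists>y\<in>F. norm (bop_apply a x - y) < 1/2"
    using compact_op_netD[OF a_compact half] by blast
  have "\<exists>y\<in>F. norm (bop_apply a (e (p k)) - y) < 1/2" for k by (rule F(2)) simp
  then have "\<forall>k. \<exists>y. y \<in> F \<and> norm (bop_apply a (e (p k)) - y) < 1/2" by blast
  then obtain y where y: "\<And>k. y k \<in> F" "\<And>k. norm (bop_apply a (e (p k)) - y k) < 1/2"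
    using choice[of "\<lambda>k y. y \<in> F \<and> norm (bop_apply a (e (p k)) - y) < 1/2"] by blast
  have "finite (range y)" by (rule finite_subset[OF _ F(1)]) (use y(1) in auto)
  then have "\<not> inj y" using finite_imageD infinite_UNIV_nat by blast
  then obtain k l where kl: "k \<noteq> l" "y k = y l" by (auto simp: inj_def)
  let ?z = "bop_apply a (e (p k)) - bop_apply a (e (p l))"
  have "norm ?z < 1"
    using norm_triangle_ineq4[of "bop_apply a (e (p k)) - y k" "bop_apply a (e (p l)) - y l"]
      y(2)[of k] y(2)[of l] kl(2) by simp
  moreover have "coef ?z (q k) = c k"
    using kl(1) by (simp add: a inj_eq[OF \<open>inj q\<close>])
  then have "cmod (c k) \<le> norm ?z"
    using cmod_cinner_le[of ?z "e (q k)"] by (simp add: coef_def)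
  ultimately show False using c[of k] by simp
qed

lemma shift_exists:
  fixes p q :: "nat \<Rightarrow> nat"
  assumes p: "inj p" and q: "inj q"
  obtains s where "\<And>k. bop_apply s (e (p k)) = e (q k)"
proof
  let ?s = "wop (indicator (range q)) (\<lambda>n. p (inv q n))"
  fix k
  have "inj_on (\<lambda>n. p (inv q n)) {n. indicator (range q) n \<noteq> (0 :: complex)}"
    by (auto simp: inj_on_def indicator_def inj_eq[OF p] inv_f_f[OF q] split: if_splits)
  then have "coef (bop_apply ?s x) n = indicator (range q) n * coef x (p (inv q n))" for x n
    by (intro coef_wop[of _ 1]) (auto simp: indicator_def)
  then show "bop_apply ?s (e (p k)) = e (q k)"
  proof (intro coef_eqI)
    fix n
    show "coef (bop_apply ?s (e (p k))) n = coef (e (q k)) n"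
      if "\<And>x n. coef (bop_apply ?s x) n = indicator (range q) n * coef x (p (inv q n))"
      by (cases "n \<in> range q") (auto simp: that inj_eq[OF p] inj_eq[OF q] inv_f_f[OF q])
  qed
qed

lemma twist_e:
  assumes "\<And>n. cmod (\<alpha> n) = 1" "bop_apply s (e m) = e n"
  shows "bop_apply (twist \<alpha> s) (e m) = (\<alpha> n * cnj (\<alpha> m)) *\<^sub>C e n"
  by (simp add: twist_def diag_e assms bop_apply_scaleC scaleC_scaleC mult.commute)

text \<open>The two candidates \<open>\<alpha>\<close> and \<open>\<lambda>n. \<beta> n * \<alpha> n\<close> conjugate a shift between the places where
  \<open>\<beta>\<close> is \<open>1\<close> and those where it is \<open>-1\<close> to opposite operators, so one of them works.\<close>

lemma escape:
  fixes b :: "'h bop \<Rightarrow> 'h bop"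
  assumes h: "growing h" and \<alpha>: "\<And>n. cmod (\<alpha> n) = 1"
  obtains \<alpha>' s where "\<And>n. cmod (\<alpha>' n) = 1" "coherent h \<alpha> \<alpha>'" "\<not> compact_op (twist \<alpha>' s - b s)"
proof -
  obtain \<beta> and p q :: "nat \<Rightarrow> nat" where \<beta>: "slow h \<beta>" "\<And>n. cmod (\<beta> n) = 1"
    and pq: "inj p" "inj q" "\<And>k. \<beta> (p k) = 1" "\<And>k. \<beta> (q k) = -1"
    by (rule alternating_slow[OF h]) (rule that)
  obtain s where s: "\<And>k. bop_apply s (e (p k)) = e (q k)"
    by (rule shift_exists[OF pq(1,2)]) (rule that)
  define \<alpha>' where "\<alpha>' n = \<beta> n * \<alpha> n" for n
  have \<alpha>': "cmod (\<alpha>' n) = 1" for n by (simp add: \<alpha>'_def norm_mult \<alpha> \<beta>)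
  have coh: "coherent h \<alpha> \<alpha>'"
    using \<beta>(1) unit_mult_cnj[OF \<alpha>] by (simp add: coherent_def \<alpha>'_def mult.assoc)
  have "\<not> compact_op (twist \<alpha> s - twist \<alpha>' s)"
  proof (rule not_compact_op_shift[OF pq(2)])
    fix k
    let ?c = "\<alpha> (q k) * cnj (\<alpha> (p k))"
    \<comment> \<open>\<open>\<beta>\<close> is 1 at \<open>p k\<close> and -1 at
      \<open>q k\<close>, so the two conjugates have opposite entries, which add up in the
      difference.\<close>
    have "bop_apply (twist \<alpha> s - twist \<alpha>' s) (e (p k)) = ?c *\<^sub>C e (q k) + ?c *\<^sub>C e (q k)"
      using pq(3,4) by (simp add: twist_e[OF \<alpha> s] twist_e[OF \<alpha>' s] \<alpha>'_def)
    then show "bop_apply (twist \<alpha> s - twist \<alpha>' s) (e (p k)) = (2 * ?c) *\<^sub>C e (q k)"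
      by (simp only: scaleC_add_left mult_2)
    show "1 \<le> cmod (2 * ?c)" by (simp add: norm_mult \<alpha>)
  qed
  moreover have "compact_op (twist \<alpha> s - twist \<alpha>' s)"
    if "compact_op (twist \<alpha> s - b s)" "compact_op (twist \<alpha>' s - b s)"
    using compact_op_diff[OF that] by simp
  ultimately consider "\<not> compact_op (twist \<alpha> s - b s)" | "\<not> compact_op (twist \<alpha>' s - b s)" by blast
  then show thesis
  proof cases
    case 1
    then show ?thesis by (rule that[OF \<alpha> coherent_refl[OF \<alpha>]])
  next
    case 2
    then show ?thesis by (rule that[OF \<alpha>' coh])
  qed
qed

text \<open>\<open>F\<close> holds the pairs of band and sequence chosen elsewhere and is consulted
  only below \<open>x\<close>. As \<open>x\<close> stands for a possible lift of an implementing
  element, the last clause compares with \<open>x * s * bop_adj x\<close>. The witness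
  \<open>s\<close> has to fit the band of this stage, so that later stages leave its image unchanged
  modulo compacts.\<close>

definition stage :: "('h bop \<times> 'h bop) set \<Rightarrow> ('h bop \<Rightarrow> (nat \<Rightarrow> nat) \<times> (nat \<Rightarrow> complex))
    \<Rightarrow> 'h bop \<Rightarrow> (nat \<Rightarrow> nat) \<times> (nat \<Rightarrow> complex) \<Rightarrow> bool" where
  "stage R F x r \<longleftrightarrow> growing (fst r) \<and> (\<forall>n. cmod (snd r n) = 1) \<and> handles (fst r) x \<and>
     (\<forall>y. (y, x) \<in> R \<longrightarrow> dominated (fst (F y)) (fst r) \<and> coherent (fst (F y)) (snd (F y)) (snd r)) \<and>
     (\<exists>s. handles (fst r) s \<and> \<not> compact_op (twist (snd r) s - x * s * bop_adj x))"

lemma stageD: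
  assumes "stage R F x r"
  shows "growing (fst r)" "cmod (snd r n) = 1" "handles (fst r) x"
    "(y, x) \<in> R \<Longrightarrow> dominated (fst (F y)) (fst r)"
    "(y, x) \<in> R \<Longrightarrow> coherent (fst (F y)) (snd (F y)) (snd r)"
    "\<exists>s. handles (fst r) s \<and> \<not> compact_op (twist (snd r) s - x * s * bop_adj x)"
proof -
  note * = assms[unfolded stage_def]
  from * show "growing (fst r)" by (rule conjunct1)
  note * = *[THEN conjunct2]
  from * show "cmod (snd r n) = 1" by (rule spec[OF conjunct1])
  note * = *[THEN conjunct2]
  from * show "handles (fst r) x" by (rule conjunct1)
  note * = *[THEN conjunct2]
  from * show "dominated (fst (F y)) (fst r)" "coherent (fst (F y)) (snd (F y)) (snd r)" if "(y, x) \<in> R"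
    using that by simp_all
  from * show "\<exists>s. handles (fst r) s \<and> \<not> compact_op (twist (snd r) s - x * s * bop_adj x)"
    by (rule conjunct2)
qed

text \<open>The order of the choices matters. Once \<open>\<alpha>\<close> is coherent with all
  predecessors, a band \<open>h1\<close> is fixed above theirs and above one for \<open>x\<close>.
  An \<open>h1\<close>-slow change of \<open>\<alpha>\<close> keeps all earlier coherences and
  yields the witness \<open>s\<close>; only now is it known how far the band has to be enlarged to
  \<open>h\<close> in order to contain \<open>s\<close>.\<close>

lemma stage_exists:
  assumes R: "trans R" "total R" "countable {y. (y, x) \<in> R}"
    and prev: "\<And>y. (y, x) \<in> R \<Longrightarrow> stage R F y (F y)"
  shows "\<exists>r. stage R F x r"
proof -
  let ?S = "{y. (y, x) \<in> R}"
  define H where "H y = fst (F y)" for y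
  define A where "A y = snd (F y)" for y
  have Fstage: "stage R F y (F y)" if "y \<in> ?S" for y
    using prev that by simp
  have gr: "growing (H y)" if "y \<in> ?S" for y
    unfolding H_def by (rule stageD(1)[OF Fstage[OF that]])
  have unit: "cmod (A y n) = 1" if "y \<in> ?S" for y n
    unfolding A_def by (rule stageD(2)[OF Fstage[OF that]])
  have old: "dominated (H y) (H z)" "coherent (H y) (A y) (A z)"
    if y: "y \<in> ?S" and z: "z \<in> ?S" and yz: "(y, z) \<in> R\<^sup>=" for y z
  proof -
    have "dominated (H y) (H z) \<and> coherent (H y) (A y) (A z)"
    proof (cases "y = z")
      case True
      then show ?thesis using coherent_refl[OF unit[OF z]] by simp
    next
      case False
      then have "(y, z) \<in> R" using yz by blast
      then show ?thesis
        unfolding H_def A_def by (intro conjI stageD(4,5)[OF Fstage[OF z]])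
    qed
    then show "dominated (H y) (H z)" "coherent (H y) (A y) (A z)" by blast+
  qed
  obtain \<alpha> where \<alpha>: "\<And>n. cmod (\<alpha> n) = 1" "\<And>y. y \<in> ?S \<Longrightarrow> coherent (H y) (A y) \<alpha>"
  proof (cases "?S = {}")
    case True
    then show ?thesis using that[of "\<lambda>_. 1"] by simp
  next
    case False
    then obtain c :: "nat \<Rightarrow> 'h bop" where c: "\<And>k. c k \<in> ?S" "\<And>k l. k \<le> l \<Longrightarrow> (c k, c l) \<in> R\<^sup>="
        "\<And>y. y \<in> ?S \<Longrightarrow> \<exists>k. (y, c k) \<in> R\<^sup>="
      by (rule cofinal_sequence[OF R(3) _ R(1,2)]) (rule that)
    obtain \<alpha> where \<alpha>: "\<And>n. cmod (\<alpha> n) = 1" "\<And>k. coherent (H (c k)) (A (c k)) \<alpha>"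
      by (rule coherent_limit[of "\<lambda>k. H (c k)" "\<lambda>k. A (c k)"])
        (rule gr[OF c(1)], rule unit[OF c(1)], rule old(2)[OF c(1) c(1) c(2)], assumption, rule that)
    have "coherent (H y) (A y) \<alpha>" if y: "y \<in> ?S" for y
    proof -
      obtain k where k: "(y, c k) \<in> R\<^sup>=" using c(3)[OF y] by blast
      have "coherent (H y) (A (c k)) \<alpha>"
        using slow_dominated[OF \<alpha>(2)[of k, unfolded coherent_def] old(1)[OF y c(1) k]]
        unfolding coherent_def .
      then show ?thesis
        by (rule coherent_trans[OF old(2)[OF y c(1) k] _ unit[OF y] unit[OF c(1)] \<alpha>(1)])
    qed
    with \<alpha>(1) show ?thesis by (rule that)
  qed
  obtain hx where hx: "handles hx x" using handles_exists by blast
  \<comment> \<open>Entry 0 is the band of \<open>x\<close>, the others enumerate the bands of the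
    predecessors. Without predecessors \<open>from_nat_into\<close> gives arbitrary indices, which
    does no harm.\<close>
  obtain h1 where h1: "growing h1" "\<And>k. dominated (case k of 0 \<Rightarrow> hx | Suc k \<Rightarrow> H (from_nat_into ?S k)) h1"
    by (rule growing_dominating) (rule that)
  have h1x: "dominated hx h1" using h1(2)[of 0] by simp
  have h1y: "dominated (H y) h1" if "y \<in> ?S" for y
    using h1(2)[of "Suc (to_nat_on ?S y)"] that R(3) by simp
  obtain \<alpha>' s where \<alpha>': "\<And>n. cmod (\<alpha>' n) = 1" "coherent h1 \<alpha> \<alpha>'"
    and s: "\<not> compact_op (twist \<alpha>' s - x * s * bop_adj x)"
    by (rule escape[OF h1(1) \<alpha>(1), where b = "\<lambda>s. x * s * bop_adj x"]) (rule that)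
  obtain hs where hs: "handles hs s" using handles_exists by blast
  obtain h where h: "growing h" "\<And>k :: nat. dominated (if k = 0 then h1 else hs) h"
    by (rule growing_dominating) (rule that)
  have h1h: "dominated h1 h" using h(2)[of 0] by simp
  have "handles h x" by (rule handles_mono[OF handles_mono[OF hx h1x] h1h])
  moreover have "handles h s" using h(2)[of 1] by (intro handles_mono[OF hs]) simp
  moreover have "dominated (H y) h \<and> coherent (H y) (A y) \<alpha>'" if y: "y \<in> ?S" for y
  proof
    show "dominated (H y) h" using h1y[OF y] h1h by (rule dominated_trans)
    have "coherent (H y) \<alpha> \<alpha>'"
      using slow_dominated[OF \<alpha>'(2)[unfolded coherent_def] h1y[OF y]] unfolding coherent_def .
    then show "coherent (H y) (A y) \<alpha>'"
      by (rule coherent_trans[OF \<alpha>(2)[OF y] _ unit[OF y] \<alpha>(1) \<alpha>'(1)])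
  qed
  ultimately have "stage R F x (h, \<alpha>')"
    using h(1) \<alpha>'(1) s unfolding stage_def H_def A_def fst_conv snd_conv by blast
  then show ?thesis by blast
qed

end

section \<open>The automorphism\<close>

lemma calkin_proj_simps:
  "calkin_proj (a + b) = calkin_proj a + calkin_proj b"
  "calkin_proj (a - b) = calkin_proj a - calkin_proj b"
  "calkin_proj (a * b) = calkin_proj a * calkin_proj b"
  "calkin_proj (c *\<^sub>C a) = c *\<^sub>C calkin_proj a"
  "calkin_proj (bop_adj a) = calkin_adj (calkin_proj a)"
  "calkin_proj 1 = 1"
  by (transfer; simp add: compact_perturb_def compact_op_zero)+

lemma calkin_proj_eq_iff: "calkin_proj a = calkin_proj b \<longleftrightarrow> compact_op (a - b)"
  by transfer (simp add: compact_perturb_def)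

lemma calkin_proj_surj: "\<exists>a. calkin_proj a = X"
proof transfer
  show "\<exists>a. compact_perturb a X" for X :: "'a bop"
    by (rule exI[of _ X]) (simp add: compact_perturb_def compact_op_zero)
qed

lemma norm_calkin_proj_le: "norm (calkin_proj a) \<le> norm a"
  by transfer (use quotient_norm_le[OF compact_op_zero] in simp)

lemma star_automorphism_conj:
  assumes "calkin_unitary v"
  shows "star_automorphism (\<lambda>x. v * x * calkin_adj v)"
proof -
  let ?w = "calkin_adj v"
  have w: "?w * v = 1" "v * ?w = 1" using assms by (auto simp: calkin_unitary_def)
  have adj_mult: "calkin_adj (x * y) = calkin_adj y * calkin_adj x" for x y :: "'a calkin"
    by transfer (simp add: bop_adj_mult compact_perturb_def compact_op_zero)
  have adj_adj: "calkin_adj (calkin_adj x) = x" for x :: "'a calkin"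
    by transfer (simp add: bop_adj_adj compact_perturb_def compact_op_zero)
  have scale: "v * c *\<^sub>C x * ?w = c *\<^sub>C (v * x * ?w)" for c x
  proof (transfer fixing: c)
    fix v x :: "'a bop"
    have "v * c *\<^sub>C x * bop_adj v = c *\<^sub>C (v * x * bop_adj v)"
      by (rule bop_eqI) (simp add: bop_apply_scaleC)
    then show "compact_perturb (v * c *\<^sub>C x * bop_adj v) (c *\<^sub>C (v * x * bop_adj v))"
      by (simp add: compact_perturb_def compact_op_zero)
  qed
  have "bij (\<lambda>x. v * x * ?w)"
  proof (rule bijI')
    show "v * x * ?w = v * y * ?w \<longleftrightarrow> x = y" for x y
    proof
      assume "v * x * ?w = v * y * ?w"
      then have "?w * (v * x * ?w) * v = ?w * (v * y * ?w) * v" by simp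
      moreover have "?w * (v * z * ?w) * v = z" for z
      proof -
        have "?w * (v * z * ?w) * v = (?w * v) * z * (?w * v)" by (simp only: mult.assoc)
        then show ?thesis by (simp add: w)
      qed
      ultimately show "x = y" by simp
    qed simp
    show "\<exists>x. y = v * x * ?w" for y
    proof (intro exI[of _ "?w * y * v"])
      have "v * (?w * y * v) * ?w = (v * ?w) * y * (v * ?w)" by (simp only: mult.assoc)
      then show "y = v * (?w * y * v) * ?w" by (simp add: w)
    qed
  qed
  moreover have "v * (x * y) * ?w = (v * x * ?w) * (v * y * ?w)" for x y
  proof -
    have "(v * x * ?w) * (v * y * ?w) = v * x * (?w * v) * y * ?w" by (simp only: mult.assoc)
    then show ?thesis by (simp add: w mult.assoc)
  qed
  ultimately show ?thesis
    unfolding star_automorphism_def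
    by (simp add: distrib_left distrib_right scale[unfolded mult.assoc] adj_mult adj_adj mult.assoc)
qed

lemma inner_automorphism_conj:
  "calkin_unitary v \<Longrightarrow> inner_automorphism (\<lambda>x. v * x * calkin_adj v)"
  unfolding inner_automorphism_def by (auto intro: star_automorphism_conj)

lemma inner_onI: "calkin_unitary v \<Longrightarrow> (\<And>x. x \<in> Y \<Longrightarrow> \<Phi> x = v * x * calkin_adj v) \<Longrightarrow> inner_on \<Phi> Y"
  unfolding inner_on_def using inner_automorphism_conj by blast

context onb
begin

section \<open>Diagonal unitaries in the Calkin algebra\<close>

lemma bop_adj_diag_unit:
  "(\<And>n. cmod (\<alpha> n) = 1) \<Longrightarrow> bop_adj (diag \<alpha>) = diag (\<lambda>n. cnj (\<alpha> n))"
  by (rule bop_adj_diag[of _ 1]) simp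

lemma calkin_unitary_diag: "(\<And>n. cmod (\<alpha> n) = 1) \<Longrightarrow> calkin_unitary (calkin_proj (diag \<alpha>))"
  unfolding calkin_unitary_def
  by (simp add: diag_cnj bop_adj_diag_unit calkin_proj_simps(6) flip: calkin_proj_simps(3,5))

lemma calkin_proj_twist:
  "(\<And>n. cmod (\<alpha> n) = 1) \<Longrightarrow> calkin_proj (twist \<alpha> a) =
     calkin_proj (diag \<alpha>) * calkin_proj a * calkin_adj (calkin_proj (diag \<alpha>))"
  by (simp add: twist_def bop_adj_diag_unit flip: calkin_proj_simps(3,5))

lemma twist_simps:
  assumes "\<And>n. cmod (\<alpha> n) = 1"
  shows "twist \<alpha> (a + b) = twist \<alpha> a + twist \<alpha> b"
    "twist \<alpha> (a - b) = twist \<alpha> a - twist \<alpha> b"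
    "twist \<alpha> (c *\<^sub>C a) = c *\<^sub>C twist \<alpha> a"
    "twist \<alpha> (a * b) = twist \<alpha> a * twist \<alpha> b"
    "twist \<alpha> (bop_adj a) = bop_adj (twist \<alpha> a)"
proof -
  show "twist \<alpha> (a + b) = twist \<alpha> a + twist \<alpha> b" "twist \<alpha> (a - b) = twist \<alpha> a - twist \<alpha> b"
    by (simp_all add: twist_def algebra_simps)
  show "twist \<alpha> (c *\<^sub>C a) = c *\<^sub>C twist \<alpha> a"
    by (rule bop_eqI) (simp add: twist_def bop_apply_scaleC)
  have "twist \<alpha> a * twist \<alpha> b
      = diag \<alpha> * a * (diag (\<lambda>n. cnj (\<alpha> n)) * diag \<alpha>) * b * diag (\<lambda>n. cnj (\<alpha> n))"
    by (simp only: twist_def mult.assoc)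
  then show "twist \<alpha> (a * b) = twist \<alpha> a * twist \<alpha> b"
    by (simp add: diag_cnj[OF assms] twist_def mult.assoc)
  show "twist \<alpha> (bop_adj a) = bop_adj (twist \<alpha> a)"
    using assms by (simp add: twist_def bop_adj_mult bop_adj_diag_unit mult.assoc)
qed

lemma twist_compact: "compact_op a \<Longrightarrow> compact_op (twist \<alpha> a)"
  unfolding twist_def by (intro compact_op_mult_right compact_op_mult_left)

text \<open>Having the basis as eigenvectors, \<open>a\<close> acts coordinatewise by continuity and
  so commutes with every diagonal unitary. The equality is exact, not only modulo compacts.\<close>

lemma twist_atomic_masa:
  assumes a: "a \<in> atomic_masa e" and \<alpha>: "\<And>n. cmod (\<alpha> n) = 1"
  shows "twist \<alpha> a = a"
proof -
  obtain c where c: "\<And>n. bop_apply a (e n) = c n *\<^sub>C e n"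
    using a unfolding atomic_masa_def by (auto simp: choice_iff)
  have a_coef: "coef (bop_apply a x) n = c n * coef x n" for x n
  proof -
    have "(\<lambda>m. bop_apply a (coef x m *\<^sub>C e m)) sums bop_apply a x"
      by (rule bounded_linear.sums[OF bop_apply_bounded_linear expansion])
    then have "(\<lambda>m. coef (bop_apply a (coef x m *\<^sub>C e m)) n) sums coef (bop_apply a x) n"
      unfolding coef_def by (rule bounded_linear.sums[OF bounded_linear_cinner_left])
    moreover have "coef (bop_apply a (coef x m *\<^sub>C e m)) n = (if m = n then coef x m * c m else 0)" for m
      by (simp add: bop_apply_scaleC c)
    ultimately have "(\<lambda>m. if m = n then coef x m * c m else 0) sums coef (bop_apply a x) n"
      by simp
    from sums_unique2[OF this sums_single] show ?thesis by simp
  qed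
  have "cmod (cnj (\<alpha> n)) = 1" for n by (simp add: \<alpha>)
  moreover have "\<alpha> n * (c n * (cnj (\<alpha> n) * z)) = c n * z" for n z
  proof -
    have "\<alpha> n * (c n * (cnj (\<alpha> n) * z)) = (\<alpha> n * cnj (\<alpha> n)) * (c n * z)" by (simp only: mult_ac)
    then show ?thesis by (simp only: unit_mult_cnj[OF \<alpha>] mult_1_left)
  qed
  ultimately show ?thesis
    by (intro bop_coef_eqI) (simp add: twist_def a_coef \<alpha>)
qed

end

theorem theorem1p1:
  fixes e :: "nat \<Rightarrow> 'h :: chilbert_space"
  assumes CH: "continuum_hypothesis"
    and e: "orthonormal_basis e"
  shows "\<exists>\<Phi> :: 'h calkin \<Rightarrow> 'h calkin.
           star_automorphism \<Phi> \<and> \<not> inner_automorphism \<Phi> \<and>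
           inner_on \<Phi> (calkin_proj ` atomic_masa e) \<and>
           (\<forall>Y. calkin_subalgebra Y \<and> separable_space (top_of_set Y) \<longrightarrow> inner_on \<Phi> Y)"
proof -
  interpret onb e by unfold_locales (rule e)
  obtain R :: "'h bop rel" where R: "wf R" "trans R" "total R" "\<And>x. countable {y. (y, x) \<in> R}"
    using CH_wellorder[OF CH bop_lepoll_reals] by blast
  have "\<exists>F. \<forall>x. stage R F x (F x)"
  proof (rule dependent_wf_choice[OF R(1)])
    show "stage R f x r = stage R g x r" if "\<And>z. (z, x) \<in> R \<Longrightarrow> f z = g z" for f g x r
      by (simp add: stage_def that)
    show "\<exists>r. stage R f x r" if "\<And>y. (y, x) \<in> R \<Longrightarrow> stage R f y (f y)" for x f
      using stage_exists[OF R(2,3,4) that] .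
  qed
  then obtain F where F: "\<And>x. stage R F x (F x)" by blast
  define H where "H x = fst (F x)" for x
  define A where "A x = snd (F x)" for x
  have gr: "growing (H x)" and unit: "cmod (A x n) = 1" and hand: "handles (H x) x" for x n
    unfolding H_def A_def by (rule stageD[OF F])+
  have coh: "coherent (H y) (A y) (A x)" if "(y, x) \<in> R" for x y
    unfolding H_def A_def by (rule stageD(5)[OF F that])
  have kill: "\<exists>s. handles (H x) s \<and> \<not> compact_op (twist (A x) s - x * s * bop_adj x)" for x
    unfolding H_def A_def by (rule stageD(6)[OF F])
  have step: "compact_op (twist (A d) a - twist (A c) a)" if "(c, d) \<in> R\<^sup>=" "handles (H c) a" for a c d
  proof (cases "c = d")
    case True
    then show ?thesis by (simp add: compact_op_zero)
  next
    case False
    then have "coherent (H c) (A c) (A d)" using that(1) coh by simp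
    then show ?thesis by (intro twist_coherent[OF gr that(2)] unit)
  qed
  \<comment> \<open>A countable set without upper bound would be cofinal, and the type would be a
    countable union of countable initial segments.\<close>
  have bound: "\<exists>d. \<forall>s\<in>S. (s, d) \<in> R\<^sup>=" if "countable S" for S
  proof (rule ccontr)
    assume unbounded: "\<not> ?thesis"
    have "\<exists>s\<in>S. (d, s) \<in> R" for d
    proof -
      obtain s where s: "s \<in> S" "(s, d) \<notin> R\<^sup>=" using unbounded by blast
      then show ?thesis using R(3) by (auto simp: total_on_def)
    qed
    then have "UNIV = (\<Union>s\<in>S. {y. (y, s) \<in> R})" by auto
    moreover have "countable (\<Union>s\<in>S. {y. (y, s) \<in> R})" using \<open>countable S\<close> R(4) by blast
    ultimately show False using uncountable_bop by simp
  qed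
  define rep where "rep X = (SOME a. calkin_proj a = X)" for X :: "'h calkin"
  have rep: "calkin_proj (rep X) = X" for X
    unfolding rep_def by (rule someI_ex) (rule calkin_proj_surj)
  \<comment> \<open>Each class is conjugated at the stage indexed by its chosen lift, whose band
    accommodates that lift.\<close>
  define \<Phi> where "\<Phi> X = calkin_proj (twist (A (rep X)) (rep X))" for X
  have \<Phi>: "\<Phi> (calkin_proj a) = calkin_proj (twist (A c) a)" if c: "handles (H c) a" for a c
  proof -
    let ?b = "rep (calkin_proj a)"
    \<comment> \<open>The stage of the chosen lift and stage \<open>c\<close> are compared at a
      common upper bound \<open>d\<close>, where the two lifts differ by a compact operator that
      stays compact under the twist.\<close>
    have "\<exists>d. \<forall>s\<in>{?b, c}. (s, d) \<in> R\<^sup>=" by (rule bound) simp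
    then obtain d where d: "(?b, d) \<in> R\<^sup>=" "(c, d) \<in> R\<^sup>=" by blast
    have "compact_op (?b - a)"
      unfolding calkin_proj_eq_iff[symmetric] by (rule rep)
    then have "compact_op (twist (A d) ?b - twist (A d) a)"
      unfolding twist_simps(2)[OF unit, symmetric] by (rule twist_compact)
    then have "calkin_proj (twist (A d) ?b) = calkin_proj (twist (A d) a)"
      by (simp only: calkin_proj_eq_iff)
    moreover have "calkin_proj (twist (A d) ?b) = \<Phi> (calkin_proj a)"
      unfolding \<Phi>_def calkin_proj_eq_iff by (rule step[OF d(1) hand])
    moreover have "calkin_proj (twist (A d) a) = calkin_proj (twist (A c) a)"
      unfolding calkin_proj_eq_iff by (rule step[OF d(2) c])
    ultimately show ?thesis by simp
  qed
  define V where "V d = calkin_proj (diag (A d))" for d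
  have V: "calkin_unitary (V d)" for d
    unfolding V_def by (rule calkin_unitary_diag) (rule unit)
  have V_auto: "star_automorphism (\<lambda>x. V d * x * calkin_adj (V d))" for d
    using V by (rule star_automorphism_conj)
  \<comment> \<open>An upper bound \<open>d\<close> of the stages of all chosen lifts serves the
    whole countable set at once. The algebraic identities follow, since each involves finitely many
    elements.\<close>
  have local: "\<exists>d. \<forall>X\<in>S. \<Phi> X = V d * X * calkin_adj (V d)"
    if S: "countable S" for S
  proof -
    have "\<exists>d. \<forall>s\<in>rep ` S. (s, d) \<in> R\<^sup>=" by (rule bound) (simp add: S)
    then obtain d where d: "\<forall>s\<in>rep ` S. (s, d) \<in> R\<^sup>=" by blast
    have "\<Phi> X = V d * X * calkin_adj (V d)" if "X \<in> S" for X
    proof -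
      have "(rep X, d) \<in> R\<^sup>=" using d that by blast
      from step[OF this hand] have "calkin_proj (twist (A d) (rep X)) = \<Phi> X"
        unfolding \<Phi>_def calkin_proj_eq_iff .
      then show ?thesis using calkin_proj_twist[of "A d" "rep X", OF unit] by (simp add: rep V_def)
    qed
    then show ?thesis by blast
  qed
  have "star_automorphism \<Phi>"
    unfolding star_automorphism_def
  proof (intro conjI allI)
    fix x y :: "'h calkin" and c :: complex
    obtain d where d: "\<forall>X\<in>{x, y, x + y, x * y, c *\<^sub>C x, calkin_adj x}. \<Phi> X = V d * X * calkin_adj (V d)"
      using local[of "{x, y, x + y, x * y, c *\<^sub>C x, calkin_adj x}"] by auto
    note * = V_auto[of d, unfolded star_automorphism_def]
    show "\<Phi> (x + y) = \<Phi> x + \<Phi> y" "\<Phi> (c *\<^sub>C x) = c *\<^sub>C \<Phi> x" "\<Phi> (x * y) = \<Phi> x * \<Phi> y"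
      "\<Phi> (calkin_adj x) = calkin_adj (\<Phi> x)"
      using d * by simp_all
  next
    show "bij \<Phi>"
    proof (rule bijI')
      fix x y
      obtain d where d: "\<forall>X\<in>{x, y}. \<Phi> X = V d * X * calkin_adj (V d)"
        using local[of "{x, y}"] by auto
      have "inj (\<lambda>x. V d * x * calkin_adj (V d))"
        using V_auto[of d] by (simp add: star_automorphism_def bij_def)
      then show "\<Phi> x = \<Phi> y \<longleftrightarrow> x = y" using d by (auto dest: injD)
    next
      fix y
      let ?b = "rep y"
      let ?u = "diag (A ?b)" and ?u' = "diag (\<lambda>n. cnj (A ?b n))"
      \<comment> \<open>Undoing the conjugation of stage \<open>?b\<close> keeps the operator in the
        band of \<open>?b\<close>, so the same stage computes \<open>\<Phi>\<close> at the
        preimage.\<close>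
      have "handles (H ?b) (?u' * ?b * ?u)"
        by (rule handles_conj[OF hand]) (simp_all add: unit)
      then have "\<Phi> (calkin_proj (?u' * ?b * ?u)) = calkin_proj (twist (A ?b) (?u' * ?b * ?u))"
        by (rule \<Phi>)
      also have "twist (A ?b) (?u' * ?b * ?u) = (?u * ?u') * ?b * (?u * ?u')"
        by (simp only: twist_def mult.assoc)
      also have "\<dots> = ?b" using diag_cnj(1)[OF unit] by simp
      finally show "\<exists>x. y = \<Phi> x" using rep[of y] by metis
    qed
  qed
  moreover have "\<not> inner_automorphism \<Phi>"
  proof
    assume "inner_automorphism \<Phi>"
    then obtain v where v: "\<And>x. \<Phi> x = v * x * calkin_adj v" by (auto simp: inner_automorphism_def)
    \<comment> \<open>Any lift of the implementing element is itself an index, and its stage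
      provides an operator on which it fails.\<close>
    obtain x where x: "calkin_proj x = v" using calkin_proj_surj by blast
    obtain s where s: "handles (H x) s" "\<not> compact_op (twist (A x) s - x * s * bop_adj x)"
      using kill by blast
    have "calkin_proj (twist (A x) s) = calkin_proj (x * s * bop_adj x)"
      using \<Phi>[OF s(1)] v[of "calkin_proj s"] x by (simp add: calkin_proj_simps)
    with s(2) show False by (simp add: calkin_proj_eq_iff)
  qed
  moreover have "inner_on \<Phi> (calkin_proj ` atomic_masa e)"
  proof (rule inner_onI[of 1])
    show "calkin_unitary (1 :: 'h calkin)"
      using calkin_unitary_diag[of "\<lambda>_. 1"] by (simp add: diag_one calkin_proj_simps(6))
    fix X assume "X \<in> calkin_proj ` atomic_masa e"
    then obtain a where a: "a \<in> atomic_masa e" "X = calkin_proj a" by blast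
    have "bop_adj (1 :: 'h bop) = 1" by (rule bop_adjI) simp
    then have one: "calkin_adj (1 :: 'h calkin) = 1"
      using calkin_proj_simps(5)[of "1 :: 'h bop"] by (simp add: calkin_proj_simps(6))
    show "\<Phi> X = 1 * X * calkin_adj 1"
      using \<Phi>[OF hand, of a] twist_atomic_masa[OF a(1) unit] by (simp add: a(2) one)
  qed
  moreover have "inner_on \<Phi> Y" if sep: "separable_space (top_of_set Y)" for Y
  proof -
    obtain S where S: "countable S" "S \<subseteq> Y" and dense: "top_of_set Y closure_of S = Y"
      using sep unfolding separable_space_def by auto
    have closure: "Y \<subseteq> closure S"
      using dense S(2) by (auto simp: closure_of_subtopology Int_absorb1)
    obtain d where d: "\<forall>X\<in>S. \<Phi> X = V d * X * calkin_adj (V d)" using local[OF S(1)] by blast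
    let ?\<Psi> = "\<lambda>X. V d * X * calkin_adj (V d)"
    have norm_V: "norm (V c) \<le> 1" "norm (calkin_adj (V c)) \<le> 1" for c
    proof -
      show "norm (V c) \<le> 1"
        unfolding V_def using norm_calkin_proj_le norm_diag_unit[OF unit] by (rule order_trans)
      have "norm (calkin_proj (diag (\<lambda>n. cnj (A c n)))) \<le> 1"
        using norm_calkin_proj_le norm_diag_unit[of "\<lambda>n. cnj (A c n)"] by (rule order_trans) (simp add: unit)
      then show "norm (calkin_adj (V c)) \<le> 1"
        by (simp add: V_def bop_adj_diag_unit[OF unit] flip: calkin_proj_simps(5))
    qed
    have "\<Phi> X = ?\<Psi> X" if X: "X \<in> Y" for X
    proof -
      have "norm (\<Phi> X - ?\<Psi> X) \<le> \<epsilon>" if \<epsilon>: "\<epsilon> > 0" for \<epsilon>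
      proof -
        have "X \<in> closure S" using X closure by blast
        then obtain Z where Z: "Z \<in> S" "dist Z X < \<epsilon> / 2"
          using \<epsilon> unfolding closure_approachable by (meson half_gt_zero)
        \<comment> \<open>The index \<open>c\<close> depends on \<open>X\<close> and
          \<open>Z\<close> and may differ from \<open>d\<close>. Both conjugations agree at
          \<open>Z\<close> and are contractive, so at \<open>X\<close> they differ by at most
          \<open>2 * dist Z X\<close>.\<close>
        obtain c where c: "\<forall>W\<in>{X, Z}. \<Phi> W = V c * W * calkin_adj (V c)"
          using local[of "{X, Z}"] by auto
        have contr: "norm (V c * W * calkin_adj (V c)) \<le> norm W" for c W
          by (rule norm_mult3_le) (rule norm_V)+
        have "\<Phi> X - ?\<Psi> X = V c * (X - Z) * calkin_adj (V c) + V d * (Z - X) * calkin_adj (V d)"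
          using c d Z(1) by (simp add: algebra_simps)
        also have "norm \<dots> \<le> norm (X - Z) + norm (Z - X)"
          by (intro norm_triangle_mono contr)
        finally show ?thesis using Z(2) by (simp add: dist_norm norm_minus_commute)
      qed
      then have "norm (\<Phi> X - ?\<Psi> X) \<le> 0" by (rule field_le_epsilon) simp
      then show ?thesis by simp
    qed
    then show ?thesis by (rule inner_onI[OF V])
  qed
  ultimately show ?thesis by blast
qed

end
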